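(* Let $K$ be a field, let $G$ be a tree on the vertex set $[n]=\{1,\ldots,n\}$ with $m$ leaves, and let $I_G\subset S=K[x_1,\ldots,x_n]$ be its edge ideal. (a) $\operatorname{dstab}(I_G)\leq n-m$. (b) Let $P$ be a path of maximal length in $G$, and suppose that all vertices of $G$ have distance at most $2$ to $P$. Then $\operatorname{dstab}(I_G)=n-m$.
   Context: Let $S=K[x_1,\ldots,x_n]$ be the polynomial ring over a field $K$ with graded maximal ideal $\mathfrak m=(x_1,\ldots,x_n)$. For a finite simple graph $G$ on $[n]$ with edge set $E(G)$, the edge ideal is the ideal $I_G\subset S$ generated by the monomials $x_ix_j$ with $\{i,j\}\in E(G)$. For a graded ideal $I\subset S$, $\operatorname{depth} S/I^k$ is constant for all $k\gg 0$ (Brodmann), and one defines $$\operatorname{dstab}(I)=\min\{k\geq 1 : \operatorname{depth} S/I^k=\operatorname{depth} S/I^l \text{ for all } l\geq k\}.$$ Here depth is taken with respect to $\mathfrak m$. A free vertex of $G$ is a vertex of degree $1$. A leaf of $G$ is an edge of $G$ containing a free vertex; for a tree with $n\geq 3$ the number of leaves equals the number of free vertices. (For $n=2$, a single edge, there is one leaf, $m=1$.) The distance of a vertex $v$ to a path $P$ in $G$ is the minimum of the graph distances from $v$ to the vertices of $P$; the length of a path is its number of edges. *)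

theory Defs
  imports
    "HOL-Library.Poly_Mapping"
    "HOL-Library.Extended_Nat"
    "HOL-Library.Cardinality"
begin

section \<open>Ideals in a commutative ring and depth of cyclic modules\<close>

text \<open>A commutative ring is a module over itself; its submodules are its ideals, so
  \<open>ideal.span B\<close> is the ideal generated by \<open>B\<close>.\<close>

interpretation ideal: module "(*) :: 'a::comm_ring_1 \<Rightarrow> 'a \<Rightarrow> 'a"
  by standard (simp_all add: algebra_simps)

primrec ideal_power :: "'a::comm_ring_1 set \<Rightarrow> nat \<Rightarrow> 'a set" where
  "ideal_power I 0 = UNIV"
| "ideal_power I (Suc k) = ideal.span {a * b | a b. a \<in> I \<and> b \<in> ideal_power I k}"

text \<open>\<open>fs\<close> is a regular sequence on the cyclic module \<open>R/J\<close>, where \<open>R\<close> is the whole type: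
  each \<open>f\<^sub>i\<close> is a nonzerodivisor on \<open>R/(J + (f\<^sub>0,\<dots>,f\<^sub>i\<^sub>-\<^sub>1))\<close>, and
  \<open>R/(J + (fs))\<close> is not zero.\<close>

definition regular_sequence_on_quotient :: "'a::comm_ring_1 set \<Rightarrow> 'a list \<Rightarrow> bool" where
  "regular_sequence_on_quotient J fs \<longleftrightarrow>
     (\<forall>i < length fs. \<forall>g. fs ! i * g \<in> ideal.span (J \<union> set (take i fs))
        \<longrightarrow> g \<in> ideal.span (J \<union> set (take i fs))) \<and>
     ideal.span (J \<union> set fs) \<noteq> UNIV"

text \<open>The supremum of the lengths of \<open>R/J\<close>-regular sequences in \<open>M\<close>. For \<open>R\<close> Noetherian,
  \<open>M\<close> a proper ideal and \<open>J \<subseteq> M\<close> it is a maximum; taking it in \<^typ>\<open>enat\<close> avoids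
  an arbitrary value otherwise.\<close>

definition depth_quotient :: "'a::comm_ring_1 set \<Rightarrow> 'a set \<Rightarrow> enat" where
  "depth_quotient M J =
     (SUP fs \<in> {fs. set fs \<subseteq> M \<and> regular_sequence_on_quotient J fs}. enat (length fs))"


section \<open>The polynomial ring in finitely many variables\<close>

text \<open>\<open>('n, 'k) mpoly\<close> is the ring of polynomials over \<open>'k\<close> in the variables \<open>x\<^sub>i\<close>,
  \<open>i :: 'n\<close>: finitely supported maps from exponent vectors to coefficients, with the convolution
  product. For finite \<open>'n\<close> the number of variables is \<open>CARD('n)\<close>.\<close>

type_synonym ('n, 'k) mpoly = "('n \<Rightarrow>\<^sub>0 nat) \<Rightarrow>\<^sub>0 'k"

definition Var :: "'n \<Rightarrow> ('n, 'k::field) mpoly" where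
  "Var i = Poly_Mapping.single (Poly_Mapping.single i 1) 1"

definition graded_maximal_ideal :: "('n, 'k::field) mpoly set" where
  "graded_maximal_ideal = ideal.span (range Var)"

definition dstab :: "('n, 'k::field) mpoly set \<Rightarrow> nat" where
  "dstab I = (LEAST k. k \<ge> 1 \<and>
     (\<forall>l \<ge> k. depth_quotient graded_maximal_ideal (ideal_power I k) =
              depth_quotient graded_maximal_ideal (ideal_power I l)))"


section \<open>Simple graphs and trees\<close>

text \<open>A graph is given by its set \<open>E\<close> of edges, which are two-element sets of vertices; its
  vertex set is the whole type \<open>'v\<close>. A walk, and in particular a path, is given by the nonempty
  list of its vertices, so its length is one less than that of the list.\<close>

definition simple_graph :: "'v set set \<Rightarrow> bool" where
  "simple_graph E \<longleftrightarrow> (\<forall>e \<in> E. card e = 2)"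

definition walk :: "'v set set \<Rightarrow> 'v list \<Rightarrow> bool" where
  "walk E p \<longleftrightarrow> p \<noteq> [] \<and> (\<forall>i. Suc i < length p \<longrightarrow> {p ! i, p ! Suc i} \<in> E)"

definition walk_length :: "'v list \<Rightarrow> nat" where
  "walk_length p = length p - 1"

definition graph_path :: "'v set set \<Rightarrow> 'v list \<Rightarrow> bool" where
  "graph_path E p \<longleftrightarrow> walk E p \<and> distinct p"

definition graph_connected :: "'v set set \<Rightarrow> bool" where
  "graph_connected E \<longleftrightarrow> (\<forall>u v. \<exists>p. walk E p \<and> hd p = u \<and> last p = v)"

definition graph_cycle :: "'v set set \<Rightarrow> 'v list \<Rightarrow> bool" where
  "graph_cycle E p \<longleftrightarrow> graph_path E p \<and> length p \<ge> 3 \<and> {last p, hd p} \<in> E"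

definition graph_tree :: "'v set set \<Rightarrow> bool" where
  "graph_tree E \<longleftrightarrow> simple_graph E \<and> graph_connected E \<and> (\<nexists>p. graph_cycle E p)"

definition vertex_degree :: "'v set set \<Rightarrow> 'v \<Rightarrow> nat" where
  "vertex_degree E v = card {e \<in> E. v \<in> e}"

definition free_vertex :: "'v set set \<Rightarrow> 'v \<Rightarrow> bool" where
  "free_vertex E v \<longleftrightarrow> vertex_degree E v = 1"

definition leaves :: "'v set set \<Rightarrow> 'v set set" where
  "leaves E = {e \<in> E. \<exists>v \<in> e. free_vertex E v}"

definition graph_dist :: "'v set set \<Rightarrow> 'v \<Rightarrow> 'v \<Rightarrow> nat" where
  "graph_dist E u v =
     (LEAST d. \<exists>p. walk E p \<and> hd p = u \<and> last p = v \<and> walk_length p = d)"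

definition dist_to_path :: "'v set set \<Rightarrow> 'v \<Rightarrow> 'v list \<Rightarrow> nat" where
  "dist_to_path E v p = Min (graph_dist E v ` set p)"

definition longest_path :: "'v set set \<Rightarrow> 'v list \<Rightarrow> bool" where
  "longest_path E p \<longleftrightarrow>
     graph_path E p \<and> (\<forall>q. graph_path E q \<longrightarrow> walk_length q \<le> walk_length p)"

definition edge_ideal :: "'n set set \<Rightarrow> ('n, 'k::field) mpoly set" where
  "edge_ideal E = ideal.span {Var i * Var j | i j. {i, j} \<in> E}"

end

theory Submission
  imports Defs
begin

text \<open>
  The theorem follows from the equality \<open>dstab I = n - m\<close> for the edge ideal \<open>I\<close> of a tree
  (lemma \<open>dstab_edge_ideal\<close>). A tree has \<open>n - 1\<close> edges, so if an edge is called inner when it is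
  not a leaf, then \<open>n - m\<close> exceeds the number of inner edges by one (when there is an edge at all).
  The claim is thus that \<open>depth S/I\<^sup>k\<close> is at least 2 as long as \<open>1 \<le> k\<close> is at most the number of
  inner edges, and is 1 afterwards.

  Powers of \<open>I\<close>. By Koenig's theorem, in the weighted form that is easy for forests
  (\<open>koenig_acyclic\<close>), a monomial \<open>x\<^sup>t\<close> lies in \<open>I\<^sup>k\<close> if and only if every vertex cover \<open>C\<close> has
  \<open>t\<close>-weight at least \<open>k\<close> (\<open>edge_ideal_power\<close>). All three depth bounds become statements about
  weights of vertex covers.

  Depth at least 1. Let \<open>a\<close> be a free vertex with neighbour \<open>b\<close>. A cover of weight less than \<open>k\<close>
  can be shrunk until it misses \<open>a\<close> or \<open>b\<close>, so a monomial outside \<open>I\<^sup>k\<close> stays outside after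
  multiplication with all powers of one of \<open>x\<^sub>a\<close>, \<open>x\<^sub>b\<close>. By the criterion
  \<open>saturated_linear_form_nonzerodivisor\<close> the form \<open>x\<^sub>a + x\<^sub>b\<close> is a nonzerodivisor on \<open>S/I\<^sup>k\<close>.

  Depth at most 1 when \<open>k\<close> exceeds the number of inner edges. Let \<open>A\<close> be a colour class of the tree
  and \<open>u\<close> the product of all inner edges and of further copies of one edge, \<open>k - 1\<close> factors in all.
  If \<open>p\<close> and \<open>q\<close> have different colours, then \<open>u x\<^sub>p x\<^sub>q \<in> I\<^sup>k\<close>: every second edge on the path from
  \<open>p\<close> to \<open>q\<close> is inner and can be traded for the others. Hence \<open>x\<^sub>p \<mapsto> u x\<^sub>p\<close> for \<open>p \<in> A\<close> and
  \<open>x\<^sub>q \<mapsto> 0\<close> for \<open>q \<notin> A\<close> defines a homomorphism from the maximal ideal to \<open>S/I\<^sup>k\<close>. A regular sequence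
  of length 2 would make it multiplication with a ring element, which it is not
  (\<open>depth_le_one_of_disconnection\<close>); in other words, it is a nonzero class in the first local
  cohomology.

  Depth at least 2 for smaller \<open>k\<close>. Modulo \<open>x\<^sub>a + x\<^sub>b\<close> the ideal \<open>I\<^sup>k\<close> remains monomial up to signs: it
  becomes the set of monomials that \<open>identify_vars\<close> describes. By the same criterion, the sum of the
  other variables is a nonzerodivisor on the quotient as soon as this monomial ideal is saturated with
  respect to the maximal ideal (\<open>in_identified_power_saturated\<close>). If it were not, one would
  find exponents for which both colour classes are covers of minimal weight \<open>k - 1\<close> and any two
  minimal covers of opposite types together exhaust the vertices. Koenig's theorem then matches these
  exponents perfectly by \<open>k - 1\<close> edges, with multiplicity. These are too few to use every inner edge,
  and cutting the tree at an unused inner edge and swapping the colours on one side yields one more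
  minimal cover, which contradicts exhaustion.
\<close>

section \<open>Connected graphs, acyclic graphs and matchings in forests\<close>

lemma cut_edge:
  assumes "graph_connected E" and X: "X \<noteq> {}" "X \<noteq> UNIV"
  shows "\<exists>p q. {p, q} \<in> E \<and> p \<in> X \<and> q \<notin> X"
proof -
  obtain u v where uv: "u \<in> X" "v \<notin> X" using X by blast
  obtain p where p: "walk E p" "hd p = u" "last p = v"
    using assms(1) unfolding graph_connected_def by blast
  have ne: "p \<noteq> []" using p(1) by (simp add: walk_def)
  define j where "j = (LEAST j. p ! j \<notin> X)"
  have last: "p ! (length p - 1) \<notin> X" using p(3) ne uv(2) by (simp add: last_conv_nth)
  have j: "p ! j \<notin> X" "j \<le> length p - 1"
    unfolding j_def using LeastI[of "\<lambda>j. p ! j \<notin> X", OF last] Least_le[of "\<lambda>j. p ! j \<notin> X", OF last] by auto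
  have "p ! 0 \<in> X" using p(2) ne uv(1) by (simp add: hd_conv_nth)
  with j(1) obtain i where i: "j = Suc i" by (cases j) auto
  have "p ! i \<in> X" using not_less_Least[of i "\<lambda>j. p ! j \<notin> X"] i by (simp add: j_def)
  moreover have "Suc i < length p" using i j(2) ne by (cases p) auto
  then have "{p ! i, p ! Suc i} \<in> E" using p(1) by (simp add: walk_def)
  ultimately show ?thesis using j(1) i by blast
qed

text \<open>Add one vertex at a time, along an edge that crosses from the current set \<open>X\<close> to its complement.
  The new vertex has a single neighbour among the edges \<open>G\<close> chosen so far, so it can be given the opposite colour;
  \<open>A\<close> is one of the two colour classes. Counting the edges of \<open>G\<close> avoids any talk of paths: it bounds
  the number of edges of a connected graph from below and shows that trees are bipartite.\<close>

lemma connected_growth: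
  fixes F :: "'v::finite set set"
  assumes conn: "\<forall>X. X \<noteq> {} \<longrightarrow> X \<noteq> UNIV \<longrightarrow> (\<exists>p q. {p, q} \<in> F \<and> p \<in> X \<and> q \<notin> X)"
  shows "Suc j \<le> CARD('v) \<Longrightarrow> \<exists>X G A. card X = Suc j \<and> G \<subseteq> F \<and> \<Union>G \<subseteq> X \<and> card G = j \<and>
           (\<forall>p q. {p, q} \<in> G \<longrightarrow> (p \<in> A \<longleftrightarrow> q \<notin> A))"
proof (induction j)
  case 0
  have "card {undefined::'v} = Suc 0" by simp
  then show ?case by (intro exI[of _ "{undefined}"] exI[of _ "{}"]) auto
next
  case (Suc j)
  from Suc.IH[OF Suc_leD[OF Suc.prems]]
  obtain X G A where X: "card X = Suc j" "G \<subseteq> F" "\<Union>G \<subseteq> X" "card G = j"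
    and A: "\<And>p q. {p, q} \<in> G \<Longrightarrow> (p \<in> A \<longleftrightarrow> q \<notin> A)" by (elim exE conjE) blast
  have "X \<noteq> UNIV" using X(1) Suc.prems by auto
  moreover have "X \<noteq> {}" using X(1) by auto
  ultimately obtain p q where pq: "{p, q} \<in> F" "p \<in> X" "q \<notin> X" using conn by blast
  define A' where "A' = (if p \<in> A then A - {q} else insert q A)"
  have new: "{p, q} \<notin> G" using pq X(3) by auto
  have "(x \<in> A' \<longleftrightarrow> y \<notin> A')" if "{x, y} \<in> insert {p, q} G" for x y
  proof (cases "{x, y} = {p, q}")
    case True
    moreover have "p \<noteq> q" using pq by auto
    ultimately show ?thesis by (auto simp: A'_def doubleton_eq_iff)
  next
    case False
    then have "{x, y} \<in> G" using that by auto
    moreover from this have "x \<noteq> q" "y \<noteq> q" using X(3) pq(3) by auto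
    ultimately show ?thesis using A[of x y] by (auto simp: A'_def)
  qed
  moreover have "card (insert q X) = Suc (Suc j)" using X(1) pq(3) by simp
  moreover have "card (insert {p, q} G) = Suc j" using new X(4) by simp
  moreover have "insert {p, q} G \<subseteq> F" "\<Union>(insert {p, q} G) \<subseteq> insert q X" using X pq by auto
  ultimately show ?case by blast
qed

lemma bipartite_spanning_subgraph:
  fixes F :: "'v::finite set set"
  assumes "\<forall>X. X \<noteq> {} \<longrightarrow> X \<noteq> UNIV \<longrightarrow> (\<exists>p q. {p, q} \<in> F \<and> p \<in> X \<and> q \<notin> X)"
  shows "\<exists>G A. G \<subseteq> F \<and> Suc (card G) = CARD('v) \<and> (\<forall>p q. {p, q} \<in> G \<longrightarrow> (p \<in> A \<longleftrightarrow> q \<notin> A))"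
proof -
  have n: "Suc (CARD('v) - 1) = CARD('v)" by simp
  have "\<exists>X G A. card X = Suc (CARD('v) - 1) \<and> G \<subseteq> F \<and> \<Union>G \<subseteq> X \<and> card G = CARD('v) - 1 \<and>
      (\<forall>p q. {p, q} \<in> G \<longrightarrow> (p \<in> A \<longleftrightarrow> q \<notin> A))"
    using assms n by (intro connected_growth) simp_all
  then show ?thesis unfolding n by (elim exE conjE) (intro exI conjI, auto)
qed

text \<open>An end of a longest path in the subgraph: another edge at this end would either prolong the
  path or close a cycle.\<close>

lemma leaf_in_acyclic_subgraph:
  fixes E :: "'v::finite set set"
  assumes simple: "simple_graph E" and acyclic: "\<nexists>p. graph_cycle E p" and FE: "F \<subseteq> E" and "F \<noteq> {}"
  shows "\<exists>a b. {a, b} \<in> F \<and> a \<noteq> b \<and> a \<notin> \<Union>(F - {{a, b}})"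
proof -
  have edge: "\<exists>x y. e = {x, y} \<and> x \<noteq> y" if "e \<in> F" for e
    using that simple FE unfolding simple_graph_def by (metis card_2_iff subsetD)
  define P where "P p \<longleftrightarrow> graph_path F p \<and> length p \<ge> 2" for p :: "'v list"
  obtain x y where "{x, y} \<in> F" "x \<noteq> y" using edge \<open>F \<noteq> {}\<close> by blast
  then have "P [x, y]" by (auto simp: P_def graph_path_def walk_def)
  moreover have "\<forall>p. P p \<longrightarrow> length p < Suc (CARD('v))"
    by (metis P_def card_mono distinct_card finite graph_path_def less_Suc_eq_le top_greatest)
  ultimately obtain p where p: "P p" and max: "\<And>q. P q \<Longrightarrow> length q \<le> length p"
    using ex_has_greatest_nat[of P "[x, y]" length] by blast
  then obtain a b r where abr: "p = a # b # r"
    by (cases p; cases "tl p") (auto simp: P_def)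
  have ab: "{a, b} \<in> F" "a \<noteq> b"
    using p unfolding P_def graph_path_def walk_def abr by (auto dest: spec[of _ 0])
  have "a \<notin> e" if e: "e \<in> F" "e \<noteq> {a, b}" for e
  proof
    assume "a \<in> e"
    with edge[OF e(1)] obtain w where w: "e = {a, w}" "w \<noteq> a" by blast
    show False
    proof (cases "w \<in> set p")
      case False
      have "walk F (w # p)"
        unfolding walk_def
      proof (intro conjI allI impI)
        fix i assume "Suc i < length (w # p)"
        then show "{(w # p) ! i, (w # p) ! Suc i} \<in> F"
          using p e(1) w by (cases i) (auto simp: P_def graph_path_def walk_def abr insert_commute)
      qed simp
      then have "P (w # p)" using False p by (auto simp: P_def graph_path_def)
      then show False using max by fastforce
    next
      case True
      then obtain i where i: "i < length p" "p ! i = w" by (auto simp: in_set_conv_nth)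
      have i2: "i \<ge> 2"
      proof (rule ccontr)
        assume "\<not> i \<ge> 2"
        then have "i = 0 \<or> i = 1" by auto
        then show False using i w e abr by auto
      qed
      let ?c = "take (Suc i) p"
      have "walk E ?c" using p FE i unfolding P_def graph_path_def walk_def by auto
      moreover have "distinct ?c" using p by (simp add: P_def graph_path_def)
      moreover have "last ?c = w" using i by (simp add: take_Suc_conv_app_nth)
      moreover have "hd ?c = a" by (simp add: abr)
      ultimately have "graph_cycle E ?c"
        unfolding graph_cycle_def graph_path_def using i i2 e(1) w FE by (auto simp: insert_commute)
      then show False using acyclic by blast
    qed
  qed
  then show ?thesis using ab by blast
qed

lemma card_acyclic:
  fixes F :: "'v::finite set set"
  assumes "\<And>G. G \<subseteq> F \<Longrightarrow> G \<noteq> {} \<Longrightarrow> \<exists>a b. {a, b} \<in> G \<and> a \<noteq> b \<and> a \<notin> \<Union>(G - {{a, b}})"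
  shows "F \<noteq> {} \<Longrightarrow> card F < card (\<Union>F)"
  using finite[of F] assms
proof (induction F rule: finite_psubset_induct)
  case (psubset F)
  obtain a b where ab: "{a, b} \<in> F" "a \<noteq> b" "a \<notin> \<Union>(F - {{a, b}})" using psubset.prems by blast
  let ?G = "F - {{a, b}}"
  have F: "card F = Suc (card ?G)" using ab(1) by (metis card_Suc_Diff1 finite)
  show ?case
  proof (cases "?G = {}")
    case True
    then have "F = {{a, b}}" using ab by auto
    then show ?thesis using ab by simp
  next
    case False
    have "card ?G < card (\<Union>?G)"
    proof (rule psubset.IH)
      show "?G \<subset> F" using ab(1) by auto
      show "?G \<noteq> {}" by (rule False)
    next
      fix G assume "G \<subseteq> ?G" "G \<noteq> {}"
      then show "\<exists>a b. {a, b} \<in> G \<and> a \<noteq> b \<and> a \<notin> \<Union>(G - {{a, b}})" using psubset.prems(2)[of G] by blast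
    qed
    moreover have "card (insert a (\<Union>?G)) \<le> card (\<Union>F)" using ab(1) by (intro card_mono) auto
    moreover have "card (insert a (\<Union>?G)) = Suc (card (\<Union>?G))" using ab(3) by (subst card_insert_disjoint) auto
    ultimately show ?thesis using F by linarith
  qed
qed

text \<open>The weighted Koenig theorem for forests: if every vertex cover has weight at least \<open>k\<close>, then
  \<open>k\<close> edges, with multiplicities \<open>w\<close>, fit below the vertex weights \<open>x\<close>. The greedy choice works: at
  a leaf \<open>{a, b}\<close> take the leaf edge as often as its ends allow, namely \<open>t\<close> times, and delete it. One of
  its ends has then lost all its weight, so a cover of the rest can be changed at \<open>a\<close> and \<open>b\<close> into a
  cover of the whole that costs exactly \<open>t\<close> more.\<close>

lemma koenig_acyclic:
  fixes F :: "'v::finite set set" and x :: "'v \<Rightarrow> nat"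
  assumes "\<And>G. G \<subseteq> F \<Longrightarrow> G \<noteq> {} \<Longrightarrow> \<exists>a b. {a, b} \<in> G \<and> a \<noteq> b \<and> a \<notin> \<Union>(G - {{a, b}})"
    and "\<And>C. (\<forall>e\<in>F. e \<inter> C \<noteq> {}) \<Longrightarrow> k \<le> sum x C"
  shows "\<exists>w. sum w F = k \<and> (\<forall>v. (\<Sum>e\<in>{e \<in> F. v \<in> e}. w e) \<le> x v)"
  using finite[of F] assms
proof (induction F arbitrary: k x rule: finite_psubset_induct)
  case (psubset F)
  show ?case
  proof (cases "F = {}")
    case True
    then show ?thesis using psubset.prems(2)[of "{}"] by auto
  next
    case False
    then obtain a b where ab: "{a, b} \<in> F" "a \<noteq> b" "a \<notin> \<Union>(F - {{a, b}})" using psubset.prems(1)[of F] by blast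
    define t where "t = min (x a) (x b)"
    define y where "y = x(a := x a - t, b := x b - t)"
    let ?G = "F - {{a, b}}"
    have xy: "sum x D = sum y D + t * card (D \<inter> {a, b})" for D
    proof -
      have "sum x D = (\<Sum>v\<in>D. y v + (if v \<in> {a, b} then t else 0))"
        using ab(2) by (intro sum.cong) (auto simp: y_def t_def)
      also have "\<dots> = sum y D + (\<Sum>v\<in>D. if v \<in> {a, b} then t else 0)" by (simp only: sum.distrib)
      also have "(\<Sum>v\<in>D. if v \<in> {a, b} then t else 0) = t * card (D \<inter> {a, b})"
        using sum.inter_restrict[of D "\<lambda>_. t" "{a, b}"] by (simp add: mult.commute)
      finally show ?thesis .
    qed
    have "\<exists>w. sum w ?G = k - t \<and> (\<forall>v. (\<Sum>e\<in>{e \<in> ?G. v \<in> e}. w e) \<le> y v)"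
    proof (rule psubset.IH)
      show "?G \<subset> F" using ab(1) by auto
    next
      fix G assume "G \<subseteq> ?G" "G \<noteq> {}"
      then show "\<exists>a b. {a, b} \<in> G \<and> a \<noteq> b \<and> a \<notin> \<Union>(G - {{a, b}})" using psubset.prems(1)[of G] by blast
    next
      fix C assume C: "\<forall>e\<in>?G. e \<inter> C \<noteq> {}"
      have C': "\<forall>e\<in>?G. e \<inter> (C - {a}) \<noteq> {}" using C ab(3) by blast
      show "k - t \<le> sum y C"
      proof (cases "b \<in> C")
        case True
        have "k \<le> sum x (C - {a})" using C' True ab(2) by (intro psubset.prems(2)) blast
        also have "\<dots> = sum y (C - {a}) + t" using xy[of "C - {a}"] True ab(2)
          by (simp add: Int_insert_right)
        also have "sum y (C - {a}) \<le> sum y C" by (intro sum_mono2) auto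
        finally show ?thesis by simp
      next
        case False
        show ?thesis
        proof (cases "x a \<le> x b")
          case True
          have "k \<le> sum x (insert a C)" using C by (intro psubset.prems(2)) blast
          also have "\<dots> = sum y (insert a C) + t" using xy[of "insert a C"] False ab(2)
            by (simp add: Int_insert_right)
          also have "sum y (insert a C) = sum y C" using True ab(2)
            by (cases "a \<in> C") (auto simp: insert_absorb y_def t_def)
          finally show ?thesis by simp
        next
          case ge: False
          have "k \<le> sum x (insert b (C - {a}))" using C' by (intro psubset.prems(2)) blast
          also have "\<dots> = sum y (insert b (C - {a})) + t" using xy[of "insert b (C - {a})"] ab(2)
            by (simp add: Int_insert_right)
          also have "sum y (insert b (C - {a})) = sum y (C - {a})" using ge False
            by (simp add: y_def t_def)
          also have "sum y (C - {a}) \<le> sum y C" by (intro sum_mono2) auto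
          finally show ?thesis by simp
        qed
      qed
    qed
    then obtain w where w: "sum w ?G = k - t" "\<And>v. (\<Sum>e\<in>{e \<in> ?G. v \<in> e}. w e) \<le> y v" by blast
    define w' where "w' = w({a, b} := min t k)"
    have w'G: "sum w' H = sum w H" if "H \<subseteq> ?G" for H using that by (intro sum.cong) (auto simp: w'_def)
    have "sum w' F = min t k + sum w' ?G" using ab(1) by (simp add: sum.remove w'_def)
    then have "sum w' F = k" using w(1) w'G[of ?G] by auto
    moreover have "(\<Sum>e\<in>{e \<in> F. v \<in> e}. w' e) \<le> x v" for v
    proof (cases "v \<in> {a, b}")
      case True
      have "(\<Sum>e\<in>{e \<in> F. v \<in> e}. w' e) = min t k + (\<Sum>e\<in>{e \<in> F. v \<in> e} - {{a, b}}. w' e)"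
        using ab(1) True by (subst sum.remove[of _ "{a, b}"]) (auto simp: w'_def)
      also have "{e \<in> F. v \<in> e} - {{a, b}} = {e \<in> ?G. v \<in> e}" by auto
      also have "sum w' \<dots> \<le> y v" using w(2)[of v] by (subst w'G) auto
      finally have "(\<Sum>e\<in>{e \<in> F. v \<in> e}. w' e) \<le> t + y v" by linarith
      also have "t + y v = x v" using True by (auto simp: y_def t_def)
      finally show ?thesis .
    next
      case False
      then have "{e \<in> F. v \<in> e} = {e \<in> ?G. v \<in> e}" by auto
      moreover have "sum w' {e \<in> ?G. v \<in> e} \<le> x v"
        using w(2)[of v] False by (subst w'G) (auto simp: y_def)
      ultimately show ?thesis by simp
    qed
    ultimately show ?thesis by blast
  qed
qed

section \<open>Cuts, colour classes and inner edges of a tree\<close>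

definition vertex_cover :: "'v set set \<Rightarrow> 'v set \<Rightarrow> bool" where
  "vertex_cover E C \<longleftrightarrow> (\<forall>e\<in>E. e \<inter> C \<noteq> {})"

lemma vertex_cover_edge: "vertex_cover E C \<Longrightarrow> {p, q} \<in> E \<Longrightarrow> p \<in> C \<or> q \<in> C"
  unfolding vertex_cover_def by (drule (1) bspec) simp

lemma sum_incident:
  fixes F :: "'v::finite set set" and w :: "'v set \<Rightarrow> nat"
  shows "(\<Sum>v\<in>C. \<Sum>e\<in>{e \<in> F. v \<in> e}. w e) = (\<Sum>e\<in>F. w e * card (e \<inter> C))"
proof -
  have "(\<Sum>v\<in>C. \<Sum>e\<in>{e \<in> F. v \<in> e}. w e) = (\<Sum>v\<in>C. \<Sum>e\<in>F. if v \<in> e then w e else 0)"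
    by (intro sum.cong refl sum.mono_neutral_cong_left) auto
  also have "\<dots> = (\<Sum>e\<in>F. \<Sum>v\<in>C. if v \<in> e then w e else 0)" by (rule sum.swap)
  also have "\<dots> = (\<Sum>e\<in>F. w e * card (e \<inter> C))"
  proof (intro sum.cong refl)
    fix e
    have "(\<Sum>v\<in>C. if v \<in> e then w e else 0) = (\<Sum>v\<in>C \<inter> e. w e)"
      by (rule sum.inter_restrict[symmetric]) simp
    then show "(\<Sum>v\<in>C. if v \<in> e then w e else 0) = w e * card (e \<inter> C)"
      by (simp add: Int_commute mult.commute)
  qed
  finally show ?thesis .
qed

locale tree_graph =
  fixes E :: "'v::finite set set"
  assumes tree: "graph_tree E"
begin

lemma edge_pair: "e \<in> E \<Longrightarrow> \<exists>p q. e = {p, q} \<and> p \<noteq> q"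
  using tree unfolding graph_tree_def simple_graph_def by (metis card_2_iff)

lemma edge_neq: "{p, q} \<in> E \<Longrightarrow> p \<noteq> q"
  using edge_pair by fastforce

lemma leaf_in_subgraph:
  "F \<subseteq> E \<Longrightarrow> F \<noteq> {} \<Longrightarrow> \<exists>a b. {a, b} \<in> F \<and> a \<noteq> b \<and> a \<notin> \<Union>(F - {{a, b}})"
  using tree by (intro leaf_in_acyclic_subgraph) (simp_all add: graph_tree_def)

lemma crossing: "\<forall>X. X \<noteq> {} \<longrightarrow> X \<noteq> UNIV \<longrightarrow> (\<exists>p q. {p, q} \<in> E \<and> p \<in> X \<and> q \<notin> X)"
  using tree by (intro allI impI cut_edge) (simp_all add: graph_tree_def)

lemma card_edges: "Suc (card E) = CARD('v)"
proof (rule antisym)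
  show "Suc (card E) \<le> CARD('v)"
  proof (cases "E = {}")
    case False
    then have "card E < card (\<Union>E)" using leaf_in_subgraph by (intro card_acyclic) auto
    also have "\<dots> \<le> CARD('v)" by (intro card_mono) auto
    finally show ?thesis by simp
  qed (simp add: Suc_le_eq)
  obtain G where "G \<subseteq> E" "Suc (card G) = CARD('v)"
    using bipartite_spanning_subgraph[of E, OF crossing] by (elim exE conjE) auto
  then show "CARD('v) \<le> Suc (card E)" using card_mono[of E G] by simp
qed

definition colour_class :: "'v set \<Rightarrow> bool" where
  "colour_class A \<longleftrightarrow> (\<forall>p q. {p, q} \<in> E \<longrightarrow> (p \<in> A \<longleftrightarrow> q \<notin> A))"

lemma colour_classD: "colour_class A \<Longrightarrow> {p, q} \<in> E \<Longrightarrow> p \<in> A \<longleftrightarrow> q \<notin> A"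
  by (simp add: colour_class_def)

lemma card_Int_colour_class:
  assumes A: "colour_class A" and e: "e \<in> E"
  shows "card (e \<inter> A) = 1" "card (e \<inter> - A) = 1"
proof -
  from edge_pair[OF e] obtain p q where pq: "e = {p, q}" by (elim exE conjE)
  then have "p \<in> A \<longleftrightarrow> q \<notin> A" using colour_classD[OF A, of p q] e by simp
  then have "e \<inter> A = {p} \<and> e \<inter> - A = {q} \<or> e \<inter> A = {q} \<and> e \<inter> - A = {p}" using pq by auto
  then show "card (e \<inter> A) = 1" "card (e \<inter> - A) = 1" by (elim disjE; simp)+
qed

lemma colour_class_cover:
  assumes "colour_class A" shows "vertex_cover E A" "vertex_cover E (- A)"
  unfolding vertex_cover_def using card_Int_colour_class[OF assms] by fastforce+

lemma bipartition:
  obtains A where "a \<in> A" "colour_class A"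
proof -
  obtain G A where G: "G \<subseteq> E" "Suc (card G) = CARD('v)"
    and A: "\<forall>p q. {p, q} \<in> G \<longrightarrow> (p \<in> A \<longleftrightarrow> q \<notin> A)"
    using bipartite_spanning_subgraph[of E, OF crossing] by (elim exE conjE) auto
  have "G = E" using G card_edges by (intro card_subset_eq) auto
  with A have "colour_class A" "colour_class (- A)" by (simp_all add: colour_class_def)
  then show ?thesis using that[of A] that[of "- A"] by (cases "a \<in> A") auto
qed

text \<open>Without \<open>{p, q}\<close> there are fewer than \<open>n - 1\<close> edges left, too few to connect all vertices; so some
  set \<open>X\<close> is not crossed by the remaining edges.\<close>

lemma edge_removal_cut:
  assumes "{p, q} \<in> E"
  obtains X where "p \<in> X" "q \<notin> X" "\<And>x y. {x, y} \<in> E \<Longrightarrow> {x, y} \<noteq> {p, q} \<Longrightarrow> x \<in> X \<longleftrightarrow> y \<in> X"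
proof -
  let ?F = "E - {{p, q}}"
  have "\<exists>X. X \<noteq> {} \<and> X \<noteq> UNIV \<and> (\<nexists>x y. {x, y} \<in> ?F \<and> x \<in> X \<and> y \<notin> X)"
  proof (rule ccontr)
    assume "\<not> ?thesis"
    then have conn: "\<forall>X. X \<noteq> {} \<longrightarrow> X \<noteq> UNIV \<longrightarrow> (\<exists>x y. {x, y} \<in> ?F \<and> x \<in> X \<and> y \<notin> X)" by blast
    obtain G where "G \<subseteq> ?F" "Suc (card G) = CARD('v)"
      using bipartite_spanning_subgraph[of ?F, OF conn] by (elim exE conjE) auto
    then have "CARD('v) \<le> Suc (card ?F)" using card_mono[of ?F G] by simp
    moreover have "card ?F < card E" using assms by (intro psubset_card_mono) auto
    ultimately show False using card_edges by simp
  qed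
  then obtain X where X: "X \<noteq> {}" "X \<noteq> UNIV"
    and no: "\<nexists>x y. {x, y} \<in> ?F \<and> x \<in> X \<and> y \<notin> X" by (elim exE conjE)
  have sep: "x \<in> X \<longleftrightarrow> y \<in> X" if "{x, y} \<in> E" "{x, y} \<noteq> {p, q}" for x y
  proof -
    have "{x, y} \<in> ?F" "{y, x} \<in> ?F" using that by (auto simp: insert_commute)
    then show ?thesis using no by blast
  qed
  obtain x y where xy: "{x, y} \<in> E" "x \<in> X" "y \<notin> X" using crossing X by blast
  then have "{x, y} = {p, q}" using sep by blast
  then consider "x = p" "y = q" | "x = q" "y = p" by (auto simp: doubleton_eq_iff)
  then show ?thesis
  proof cases
    case 1 then show ?thesis using that[of X] xy sep by blast
  next
    case 2 then show ?thesis using that[of "- X"] xy sep by blast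
  qed
qed

definition inner_edges where "inner_edges = E - leaves E"

lemma card_inner: "E \<noteq> {} \<Longrightarrow> CARD('v) - card (leaves E) = Suc (card inner_edges)"
proof -
  have le: "leaves E \<subseteq> E" by (auto simp: leaves_def)
  then have "card inner_edges = card E - card (leaves E)" "card (leaves E) \<le> card E"
    by (simp_all add: inner_edges_def card_Diff_subset card_mono)
  then show ?thesis using card_edges by linarith
qed

lemma inner_edge_extends:
  assumes "{p, q} \<in> inner_edges"
  shows "\<exists>r. {p, r} \<in> E \<and> {p, r} \<noteq> {p, q}"
proof -
  have pq: "{p, q} \<in> E" "\<not> free_vertex E p" using assms unfolding inner_edges_def leaves_def by blast+
  have "{e \<in> E. p \<in> e} \<noteq> {{p, q}}"
  proof
    assume "{e \<in> E. p \<in> e} = {{p, q}}"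
    then have "vertex_degree E p = 1" by (simp add: vertex_degree_def)
    then show False using pq(2) by (simp add: free_vertex_def)
  qed
  then obtain e where "e \<in> E" "p \<in> e" "e \<noteq> {p, q}" using pq(1) by auto
  moreover from this obtain r where "e = {p, r}" using edge_pair[of e] by blast
  ultimately show ?thesis by blast
qed

lemma free_vertex_unique:
  assumes "free_vertex E v" "e \<in> E" "v \<in> e" "e' \<in> E" "v \<in> e'"
  shows "e = e'"
proof -
  have "card {e \<in> E. v \<in> e} = 1" using assms(1) by (simp add: free_vertex_def vertex_degree_def)
  then obtain c where c: "{e \<in> E. v \<in> e} = {c}" by (rule card_1_singletonE)
  have "e \<in> {e \<in> E. v \<in> e}" "e' \<in> {e \<in> E. v \<in> e}" using assms(2-5) by simp_all
  then show ?thesis unfolding c by simp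
qed

lemma koenig:
  fixes x :: "'v \<Rightarrow> nat"
  assumes "\<And>C. vertex_cover E C \<Longrightarrow> k \<le> sum x C"
  shows "\<exists>w. sum w E = k \<and> (\<forall>v. (\<Sum>e\<in>{e \<in> E. v \<in> e}. w e) \<le> x v)"
proof (rule koenig_acyclic)
  show "\<exists>a b. {a, b} \<in> G \<and> a \<noteq> b \<and> a \<notin> \<Union>(G - {{a, b}})" if "G \<subseteq> E" "G \<noteq> {}" for G
    using leaf_in_subgraph that .
  show "k \<le> sum x C" if "\<forall>e\<in>E. e \<inter> C \<noteq> {}" for C
    using assms that by (simp add: vertex_cover_def)
qed

text \<open>This is what makes \<open>u x\<^sub>i x\<^sub>j\<close> a member of \<open>I\<^sup>k\<close>, where \<open>u\<close> is the product of the inner edges. Suppose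
  that the cover \<open>C\<close> contains neither \<open>i\<close> nor \<open>j\<close>. Starting from \<open>i\<close>, exactness on the inner
  edges forces \<open>C\<close> to agree with the complement of \<open>A\<close> on every vertex that is not free; the set \<open>R\<close>
  collects these vertices, and \<open>R'\<close> adds the free vertices next to them. No edge leaves \<open>R'\<close>, so
  \<open>j\<close> belongs to it, and then the edge that joins \<open>j\<close> to \<open>R\<close> is not covered.\<close>

lemma tight_cover_meets:
  assumes A': "colour_class A"
    and C: "vertex_cover E C" and tight: "\<And>e. e \<in> inner_edges \<Longrightarrow> \<not> e \<subseteq> C"
    and ij: "i \<in> A" "j \<notin> A"
  shows "i \<in> C \<or> j \<in> C"
proof (rule ccontr)
  assume "\<not> ?thesis"
  then have nC: "i \<notin> C" "j \<notin> C" by auto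
  note A = colour_classD[OF A']
  have cov: "p \<in> C \<or> q \<in> C" if "{p, q} \<in> E" for p q using vertex_cover_edge[OF C that] .
  define R where "R = insert i {v. \<not> free_vertex E v \<and> (v \<in> C \<longleftrightarrow> v \<notin> A)}"
  define R' where "R' = R \<union> {v. free_vertex E v \<and> (\<exists>r\<in>R. {r, v} \<in> E)}"
  have RC: "v \<in> C \<longleftrightarrow> v \<notin> A" if "v \<in> R" for v using that nC ij by (auto simp: R_def)
  have "j \<in> R'"
  proof (rule ccontr)
    assume "j \<notin> R'"
    moreover have "i \<in> R'" by (simp add: R'_def R_def)
    ultimately obtain p q where pq: "{p, q} \<in> E" "p \<in> R'" "q \<notin> R'" using crossing by blast
    show False
    proof (cases "p \<in> R")
      case True
      have nf: "\<not> free_vertex E q" using pq True by (auto simp: R'_def)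
      have "q \<in> C \<longleftrightarrow> q \<in> A" using nf pq(3) by (auto simp: R'_def R_def)
      then have both: "p \<in> C" "q \<in> C" using RC[OF True] cov[OF pq(1)] A[OF pq(1)] by auto
      then have "\<not> free_vertex E p" using True nC by (auto simp: R_def)
      then have "{p, q} \<in> inner_edges" using nf pq(1) by (auto simp: inner_edges_def leaves_def)
      then show False using tight both by blast
    next
      case False
      then obtain r where r: "free_vertex E p" "r \<in> R" "{r, p} \<in> E" using pq(2) by (auto simp: R'_def)
      then have "{p, q} = {r, p}" using pq(1) by (intro free_vertex_unique[of p]) auto
      then have "q = r" by (auto simp: doubleton_eq_iff)
      then show False using pq(3) r(2) by (auto simp: R'_def)
    qed
  qed
  then consider "j \<in> R" | r where "r \<in> R" "{r, j} \<in> E" by (auto simp: R'_def)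
  then show False
  proof cases
    case 1 then show False using RC nC ij by blast
  next
    case 2 then show False using RC[of r] nC ij A[of r j] cov[of r j] by blast
  qed
qed

end

section \<open>Saturation of the powers after identifying a leaf with its neighbour\<close>

context tree_graph begin

text \<open>Delete the inner edge \<open>e\<close> and take the colour class \<open>A\<close> on one side of the cut, its complement on
  the other side. The sides are named so that both ends of \<open>e\<close> are taken. Since \<open>e\<close> has multiplicity 0,
  the weight of this cover is the number of edges counted with multiplicity, as it is for a colour class.
  Neither colour class is contained in it, because an inner edge has another edge attached at both ends.\<close>

lemma unused_edge_gives_cover:
  assumes "colour_class A"
    and e: "e \<in> inner_edges" "w e = 0"
  shows "\<exists>C. vertex_cover E C \<and> (\<forall>p q. {p, q} \<in> E - inner_edges \<longrightarrow> (p \<in> C \<longleftrightarrow> q \<notin> C)) \<and>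
    \<not> A \<subseteq> C \<and> \<not> - A \<subseteq> C \<and> (\<Sum>e\<in>E. w e * card (e \<inter> C)) = sum w E"
proof -
  note A = colour_classD[OF assms(1)]
  have eE: "e \<in> E" using e(1) by (simp add: inner_edges_def)
  obtain p q where pq: "e = {p, q}" "p \<in> A" "q \<notin> A"
  proof -
    obtain x y where xy: "e = {x, y}" using edge_pair[OF eE] by blast
    show ?thesis
    proof (cases "x \<in> A")
      case True then show ?thesis using that[of x y] xy A[of x y] eE by simp
    next
      case False then show ?thesis using that[of y x] xy A[of x y] eE by (simp add: insert_commute)
    qed
  qed
  obtain X where X: "p \<in> X" "q \<notin> X"
    and sep: "\<And>x y. {x, y} \<in> E \<Longrightarrow> {x, y} \<noteq> {p, q} \<Longrightarrow> x \<in> X \<longleftrightarrow> y \<in> X"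
    using edge_removal_cut[of p q] eE pq(1) by metis
  define C where "C = (A \<inter> X) \<union> (- A - X)"
  have sepC: "x \<in> C \<longleftrightarrow> y \<notin> C" if "{x, y} \<in> E" "{x, y} \<noteq> e" for x y
    using sep[of x y] A[of x y] that pq(1) by (auto simp: C_def)
  have one: "card (f \<inter> C) = 1" if f: "f \<in> E" "f \<noteq> e" for f
  proof -
    obtain x y where xy: "f = {x, y}" "x \<noteq> y" using edge_pair[OF f(1)] by blast
    then have "x \<in> C \<longleftrightarrow> y \<notin> C" using sepC[of x y] f by simp
    then have "f \<inter> C = {x} \<or> f \<inter> C = {y}" using xy by auto
    then show ?thesis by auto
  qed
  have cov: "vertex_cover E C"
    unfolding vertex_cover_def
  proof
    fix f assume f: "f \<in> E"
    show "f \<inter> C \<noteq> {}"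
    proof (cases "f = e")
      case True then show ?thesis using pq X by (auto simp: C_def)
    next
      case False
      then have "card (f \<inter> C) = 1" using one f by blast
      then show ?thesis by auto
    qed
  qed
  have leafC: "x \<in> C \<longleftrightarrow> y \<notin> C" if "{x, y} \<in> E - inner_edges" for x y
    using that e(1) by (intro sepC) auto
  have "{q, p} \<in> inner_edges" "{p, q} \<in> inner_edges" using e(1) pq(1) by (simp_all add: insert_commute)
  then obtain r s where r: "{q, r} \<in> E" "{q, r} \<noteq> {q, p}" and s: "{p, s} \<in> E" "{p, s} \<noteq> {p, q}"
    using inner_edge_extends by metis
  have r': "{q, r} \<noteq> {p, q}" using r(2) by (simp add: insert_commute)
  have "r \<in> A" "r \<notin> C" using A[OF r(1)] sep[OF r(1) r'] pq X by (auto simp: C_def)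
  moreover have "s \<notin> A" "s \<notin> C" using A[OF s(1)] sep[OF s] pq X by (auto simp: C_def)
  moreover have "(\<Sum>f\<in>E. w f * card (f \<inter> C)) = sum w E"
  proof (rule sum.cong[OF refl])
    fix f assume "f \<in> E"
    then show "w f * card (f \<inter> C) = w f" using one[of f] e(2) by (cases "f = e") simp_all
  qed
  ultimately show ?thesis using cov leafC by (intro exI[of _ C]) blast
qed

text \<open>The monomials of the \<open>k\<close>-th power after \<open>x\<^sub>a\<close> has been identified with \<open>x\<^sub>b\<close> up to sign: the total
  exponent of \<open>x\<^sub>a\<close> and \<open>x\<^sub>b\<close> may be redistributed between them to reach a monomial of the power.\<close>

definition in_identified_power where
  "in_identified_power a b k x \<longleftrightarrow> (\<exists>y. (\<forall>v. v \<noteq> a \<longrightarrow> v \<noteq> b \<longrightarrow> y v = x v) \<and> y a + y b = x a + x b \<and>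
     (\<forall>C. vertex_cover E C \<longrightarrow> k \<le> sum y C))" for x :: "'v \<Rightarrow> nat"

lemma in_identified_power_mono:
  assumes "in_identified_power a b k x" "\<And>v. x v \<le> x' v"
  shows "in_identified_power a b k x'"
proof -
  obtain y where y: "\<And>v. v \<noteq> a \<Longrightarrow> v \<noteq> b \<Longrightarrow> y v = x v" "y a + y b = x a + x b"
    "\<And>C. vertex_cover E C \<Longrightarrow> k \<le> sum y C"
    using assms(1) unfolding in_identified_power_def by auto
  define y' where "y' v = y v + (x' v - x v)" for v
  have "y' v = x' v" if "v \<noteq> a" "v \<noteq> b" for v using y(1)[OF that] assms(2)[of v] by (simp add: y'_def)
  moreover have "y' a + y' b = x' a + x' b" using y(2) assms(2)[of a] assms(2)[of b] by (simp add: y'_def)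
  moreover have "k \<le> sum y' C" if "vertex_cover E C" for C
    using y(3)[OF that] sum_mono[of C y y'] by (simp add: y'_def)
  ultimately show ?thesis unfolding in_identified_power_def by blast
qed

lemma sum_split_at_leaf:
  fixes x y :: "'v \<Rightarrow> nat"
  assumes "\<forall>v. v \<noteq> a \<and> v \<noteq> b \<longrightarrow> y v = x v"
  shows "a \<in> C \<Longrightarrow> b \<notin> C \<Longrightarrow> sum y C = y a + sum x (C - {a, b})"
    and "a \<notin> C \<Longrightarrow> b \<in> C \<Longrightarrow> sum y C = y b + sum x (C - {a, b})"
    and "a \<noteq> b \<Longrightarrow> a \<in> C \<Longrightarrow> b \<in> C \<Longrightarrow> sum y C = y a + y b + sum x (C - {a, b})"
proof -
  have rest: "sum y (C - {a, b}) = sum x (C - {a, b})" using assms by (intro sum.cong) auto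
  have C: "sum y C = sum y (C \<inter> {a, b}) + sum y (C - {a, b})" 
    by (subst sum.union_disjoint[symmetric]) (auto intro!: arg_cong[of _ _ "sum y"])
  show "a \<in> C \<Longrightarrow> b \<notin> C \<Longrightarrow> sum y C = y a + sum x (C - {a, b})"
    unfolding C rest by (simp add: Int_insert_right)
  show "a \<notin> C \<Longrightarrow> b \<in> C \<Longrightarrow> sum y C = y b + sum x (C - {a, b})"
    unfolding C rest by (simp add: Int_insert_right)
  show "a \<noteq> b \<Longrightarrow> a \<in> C \<Longrightarrow> b \<in> C \<Longrightarrow> sum y C = y a + y b + sum x (C - {a, b})"
    unfolding C rest by (simp add: Int_insert_right)
qed

text \<open>A cover through \<open>a\<close> only and a cover through \<open>b\<close> only see the two shares of the total exponent
  \<open>x a + x b\<close>; adding their inequalities eliminates the way in which it is shared.\<close>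

lemma in_identified_powerD:
  assumes "in_identified_power a b k x"
  shows "vertex_cover E C2 \<Longrightarrow> a \<notin> C2 \<Longrightarrow> b \<in> C2 \<Longrightarrow> k \<le> x a + x b + sum x (C2 - {a, b})"
    and "vertex_cover E C1 \<Longrightarrow> a \<in> C1 \<Longrightarrow> b \<notin> C1 \<Longrightarrow> vertex_cover E C2 \<Longrightarrow> a \<notin> C2 \<Longrightarrow> b \<in> C2 \<Longrightarrow>
      2 * k \<le> x a + x b + sum x (C1 - {a, b}) + sum x (C2 - {a, b})"
proof -
  obtain y where y: "\<forall>v. v \<noteq> a \<and> v \<noteq> b \<longrightarrow> y v = x v" "y a + y b = x a + x b"
    "\<And>C. vertex_cover E C \<Longrightarrow> k \<le> sum y C"
    using assms unfolding in_identified_power_def by auto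
  note sp = sum_split_at_leaf[of a b y x, OF y(1)]
  show "k \<le> x a + x b + sum x (C2 - {a, b})" if "vertex_cover E C2" "a \<notin> C2" "b \<in> C2"
    using y(2) y(3)[OF that(1)] sp(2)[of C2] that by linarith
  show "2 * k \<le> x a + x b + sum x (C1 - {a, b}) + sum x (C2 - {a, b})"
    if "vertex_cover E C1" "a \<in> C1" "b \<notin> C1" "vertex_cover E C2" "a \<notin> C2" "b \<in> C2"
    using y(2) y(3)[OF that(1)] y(3)[OF that(4)] sp(1)[of C1] sp(2)[of C2] that by linarith
qed

end

locale tree_with_leaf = tree_graph E for E :: "'v::finite set set" +
  fixes a b :: 'v
  assumes ab: "{a, b} \<in> E" and leaf: "\<And>e. e \<in> E \<Longrightarrow> a \<in> e \<Longrightarrow> e = {a, b}"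
begin

text \<open>Every cover contains \<open>a\<close> or \<open>b\<close>, and one that contains \<open>b\<close> can drop the free vertex \<open>a\<close>. So only
  the covers through exactly one of them matter.\<close>

definition "cover_a C \<longleftrightarrow> vertex_cover E C \<and> a \<in> C \<and> b \<notin> C"
definition "cover_b C \<longleftrightarrow> vertex_cover E C \<and> a \<notin> C \<and> b \<in> C"

lemma a_neq_b: "a \<noteq> b" using edge_neq[OF ab] .

lemma leaf_not_inner: "{a, b} \<notin> inner_edges"
proof -
  have "{e \<in> E. a \<in> e} = {{a, b}}"
  proof (intro equalityI subsetI)
    show "e \<in> {{a, b}}" if "e \<in> {e \<in> E. a \<in> e}" for e using leaf[of e] that by simp
  qed (use ab in simp)
  then have "free_vertex E a" by (simp add: free_vertex_def vertex_degree_def)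
  then show ?thesis by (simp add: inner_edges_def leaves_def)
qed

lemma cover_remove_a:
  assumes "vertex_cover E C" "b \<in> C" shows "vertex_cover E (C - {a})"
  using assms leaf a_neq_b unfolding vertex_cover_def by fastforce

lemma cover_exchange:
  assumes "cover_a C" shows "cover_b (insert b (C - {a}))" "insert b (C - {a}) - {a, b} = C - {a, b}"
proof -
  have "vertex_cover E (insert b C)" using assms by (auto simp: cover_a_def vertex_cover_def)
  then have "vertex_cover E (insert b C - {a})" by (rule cover_remove_a) simp
  moreover have "insert b C - {a} = insert b (C - {a})" using a_neq_b by auto
  ultimately show "cover_b (insert b (C - {a}))" using a_neq_b by (auto simp: cover_b_def)
  show "insert b (C - {a}) - {a, b} = C - {a, b}" by auto
qed

lemma optimal_covers:
  fixes x :: "'v \<Rightarrow> nat"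
  obtains C1 C2 where "cover_a C1" "cover_b C2"
    "\<And>C. cover_a C \<Longrightarrow> sum x (C1 - {a, b}) \<le> sum x (C - {a, b})"
    "\<And>C. cover_b C \<Longrightarrow> sum x (C2 - {a, b}) \<le> sum x (C - {a, b})"
    "sum x (C2 - {a, b}) \<le> sum x (C1 - {a, b})"
proof -
  have "cover_a (- {b})"
    unfolding cover_a_def vertex_cover_def
  proof (intro conjI ballI)
    fix e assume "e \<in> E"
    then obtain p q where "e = {p, q}" "p \<noteq> q" using edge_pair by blast
    then show "e \<inter> - {b} \<noteq> {}" by auto
  qed (use a_neq_b in auto)
  then obtain C1 where C1: "cover_a C1" "\<And>C. cover_a C \<Longrightarrow> sum x (C1 - {a, b}) \<le> sum x (C - {a, b})"
    using ex_has_least_nat[of cover_a "- {b}" "\<lambda>C. sum x (C - {a, b})"] by blast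
  obtain C2 where C2: "cover_b C2" "\<And>C. cover_b C \<Longrightarrow> sum x (C2 - {a, b}) \<le> sum x (C - {a, b})"
    using ex_has_least_nat[of cover_b _ "\<lambda>C. sum x (C - {a, b})", OF cover_exchange(1)[OF C1(1)]] by blast
  show ?thesis using that[OF C1(1) C2(1) C1(2) C2(2)] C2(2)[OF cover_exchange(1)[OF C1(1)]]
    unfolding cover_exchange(2)[OF C1(1)] by blast
qed

text \<open>Conversely, the two families of inequalities suffice. Give \<open>a\<close> just the share \<open>i\<close> that the lightest cover
  through \<open>a\<close> requires, and the remainder to \<open>b\<close>. Exchanging \<open>a\<close> for \<open>b\<close> shows that the lightest cover
  through \<open>b\<close> weighs no more elsewhere than the lightest one through \<open>a\<close>; this is why \<open>i\<close> does not exceed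
  the total.\<close>

lemma in_identified_powerI:
  assumes 1: "\<And>C. cover_b C \<Longrightarrow> k \<le> x a + x b + sum x (C - {a, b})"
    and 2: "\<And>C C'. cover_a C \<Longrightarrow> cover_b C' \<Longrightarrow>
      2 * k \<le> x a + x b + sum x (C - {a, b}) + sum x (C' - {a, b})"
  shows "in_identified_power a b k x"
proof -
  define r where "r C = sum x (C - {a, b})" for C
  obtain C1 C2 where C: "cover_a C1" "cover_b C2"
    "\<And>C. cover_a C \<Longrightarrow> r C1 \<le> r C" "\<And>C. cover_b C \<Longrightarrow> r C2 \<le> r C" "r C2 \<le> r C1"
    using optimal_covers[of x] unfolding r_def by metis
  define d where "d = x a + x b"
  define i where "i = k - r C1"
  have h: "k \<le> d + r C2" "2 * k \<le> d + r C1 + r C2"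
    using 1[OF C(2)] 2[OF C(1,2)] by (simp_all add: d_def r_def)
  then have i: "k \<le> i + r C1" "k \<le> (d - i) + r C2" "i \<le> d" using C(5) by (auto simp: i_def)
  define y where "y = x(a := i, b := d - i)"
  have yx: "\<forall>v. v \<noteq> a \<and> v \<noteq> b \<longrightarrow> y v = x v" by (simp add: y_def)
  have yab: "y a = i" "y b = d - i" using a_neq_b by (simp_all add: y_def)
  note sp = sum_split_at_leaf[OF yx, folded r_def]
  have "k \<le> sum y C" if cov: "vertex_cover E C" for C
  proof (cases "b \<in> C")
    case False
    then have "a \<in> C" using vertex_cover_edge[OF cov ab] by simp
    then have "cover_a C" using False cov by (simp add: cover_a_def)
    then show ?thesis using C(3)[of C] sp(1)[of C] yab i(1) \<open>a \<in> C\<close> False by linarith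
  next
    case True
    have "cover_b (C - {a})" using cover_remove_a[OF cov True] True a_neq_b by (simp add: cover_b_def)
    moreover have "r (C - {a}) = r C" by (simp add: r_def insert_commute Diff_insert2[symmetric])
    ultimately have "r C2 \<le> r C" using C(4) by metis
    then show ?thesis using sp(2)[of C] sp(3)[of C] a_neq_b True yab i(2) by (cases "a \<in> C") auto
  qed
  moreover have "y a + y b = x a + x b" using yab i(3) by (simp add: d_def)
  ultimately show ?thesis unfolding in_identified_power_def using yx by (intro exI[of _ y]) blast
qed

text \<open>Suppose that every variable other than \<open>x\<^sub>a\<close> has a power that takes the monomial into the ideal, but
  the monomial is not in it. Then an inequality of \<open>in_identified_powerI\<close> fails. Those for a single cover
  through \<open>b\<close> cannot fail, since such a cover can be taken to miss a third vertex \<open>v\<close>, and raising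
  \<open>v\<close> does not change its weight. So an inequality for a pair of covers fails. For the same reason every pair
  for which it fails exhausts the vertices.
  This exhaustion is refuted by a perfect matching together with \<open>unused_edge_gives_cover\<close>.\<close>

lemma in_identified_power_saturated:
  assumes k: "1 \<le> k" "k \<le> card inner_edges"
    and sat: "\<And>v. v \<noteq> a \<Longrightarrow> \<exists>s. in_identified_power a b k (x(v := x v + s))"
  shows "in_identified_power a b k x"
proof (rule ccontr)
  assume bad: "\<not> in_identified_power a b k x"
  define r where "r C = sum x (C - {a, b})" for C
  define d where "d = x a + x b"
  have free: "r (C - {v}) \<le> r C" "v \<notin> C \<Longrightarrow> sum (x(b := u, v := t)) (C - {a, b}) = r C" for C v t u
  proof -
    show "r (C - {v}) \<le> r C" unfolding r_def by (rule sum_mono2) auto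
    show "v \<notin> C \<Longrightarrow> sum (x(b := u, v := t)) (C - {a, b}) = r C"
      unfolding r_def by (rule sum.cong) auto
  qed
  have sat': "\<exists>s. in_identified_power a b k (x(b := x b + u, v := x v + s))" if "v \<noteq> a" "v \<noteq> b" for u v
  proof -
    obtain s where "in_identified_power a b k (x(v := x v + s))" using sat \<open>v \<noteq> a\<close> by blast
    then have "in_identified_power a b k (x(b := x b + u, v := x v + s))"
      by (rule in_identified_power_mono) simp
    then show ?thesis ..
  qed
  have single: "k \<le> d + u + r C" if C: "cover_b C" for C u
  proof -
    have "inner_edges \<noteq> {}" using k by auto
    then obtain f where f: "f \<in> inner_edges" by blast
    then have fE: "f \<in> E" by (simp add: inner_edges_def)
    from edge_pair[OF this] obtain p q where pq: "f = {p, q}" "p \<noteq> q" by (elim exE conjE)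
    have "a \<notin> f" using leaf[OF fE] leaf_not_inner f by auto
    then have "p \<noteq> a" "q \<noteq> a" using pq by auto
    then obtain z where z: "z \<noteq> a" "z \<noteq> b" using pq(2) by metis
    obtain v C' where v: "v \<noteq> a" "v \<noteq> b" "v \<notin> C'" "cover_b C'" "r C' \<le> r C"
    proof (cases "\<exists>v. v \<noteq> a \<and> v \<noteq> b \<and> v \<notin> C")
      case True
      then show ?thesis using that[of _ C] C by blast
    next
      case False
      have "vertex_cover E (C - {z})"
        unfolding vertex_cover_def
      proof
        fix e assume e: "e \<in> E"
        show "e \<inter> (C - {z}) \<noteq> {}"
        proof (cases "a \<in> e")
          case True
          then have "b \<in> e" using leaf[OF e] by simp
          then show ?thesis using C z by (auto simp: cover_b_def)
        next
          case na: False
          obtain p q where "e = {p, q}" "p \<noteq> q" using edge_pair[OF e] by blast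
          moreover from this have "p \<in> C" "q \<in> C" using na False C by (auto simp: cover_b_def)
          ultimately show ?thesis by auto
        qed
      qed
      then have "cover_b (C - {z})" using C z by (auto simp: cover_b_def)
      then show ?thesis using that[of z "C - {z}"] z free(1) by blast
    qed
    obtain s where "in_identified_power a b k (x(b := x b + u, v := x v + s))" using sat' v by blast
    from in_identified_powerD(1)[OF this, of C'] have "k \<le> d + u + r C'"
      using v a_neq_b free(2)[of v C'] by (simp add: cover_b_def d_def)
    then show ?thesis using v(5) by linarith
  qed
  obtain C1 C2 where C: "cover_a C1" "cover_b C2"
    "\<And>C. cover_a C \<Longrightarrow> r C1 \<le> r C" "\<And>C. cover_b C \<Longrightarrow> r C2 \<le> r C" "r C2 \<le> r C1"
    using optimal_covers[of x] unfolding r_def by metis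
  have "d + r C1 + r C2 < 2 * k"
  proof (rule ccontr)
    assume nl: "\<not> d + r C1 + r C2 < 2 * k"
    have "in_identified_power a b k x"
    proof (rule in_identified_powerI)
      show "k \<le> x a + x b + sum x (C - {a, b})" if "cover_b C" for C
        using single[OF that, of 0] by (simp add: d_def r_def)
      show "2 * k \<le> x a + x b + sum x (C - {a, b}) + sum x (C' - {a, b})"
        if "cover_a C" "cover_b C'" for C C'
        using C(3)[OF that(1)] C(4)[OF that(2)] nl by (simp add: d_def r_def)
    qed
    then show False using bad by simp
  qed
  \<comment> \<open>Raising the exponent of \<open>x\<^sub>b\<close> by \<open>u\<close> leaves all \<open>r C\<close> unchanged and makes the failing
    inequality for the optimal pair fail by exactly one, so that exactly the optimal pairs violate it.\<close>
  then obtain u where u: "d + u + r C1 + r C2 = 2 * k - 1"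
    by (metis Suc_diff_1 add.assoc add.commute k(1) le_add_diff_inverse less_Suc_eq_le mult_pos_pos zero_less_numeral less_eq_Suc_le One_nat_def)
  have top: "v \<in> D1 \<union> D2" if "cover_a D1" "r D1 = r C1" "cover_b D2" "r D2 = r C2" for v D1 D2
  proof (rule ccontr)
    assume nv: "v \<notin> D1 \<union> D2"
    then have v: "v \<noteq> a" "v \<noteq> b" using that by (auto simp: cover_a_def cover_b_def)
    then obtain s where "in_identified_power a b k (x(b := x b + u, v := x v + s))" using sat' by blast
    from in_identified_powerD(2)[OF this, of D1 D2] have "2 * k \<le> d + u + r D1 + r D2"
      using v a_neq_b nv that free(2)[of v D1] free(2)[of v D2] by (simp add: cover_a_def cover_b_def d_def)
    then show False using u that k by simp
  qed
  obtain A where aA: "a \<in> A" and A': "colour_class A"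
    using bipartition[of a] by metis
  note A = colour_classD[OF A']
  have bA: "b \<notin> A" using A[OF ab] aA by simp
  have AB: "cover_a A" "cover_b (- A)"
    using colour_class_cover[OF A'] aA bA by (simp_all add: cover_a_def cover_b_def)
  \<comment> \<open>The optimal pair covers every vertex, so its joint weight is at least that of \<open>A\<close> and \<open>- A\<close>; hence
    the two colour classes are optimal as well.\<close>
  have rAB: "r A = r C1" "r (- A) = r C2"
  proof -
    have all: "C1 \<union> C2 = UNIV" using top[OF C(1) refl C(2) refl] by auto
    have "r A + r (- A) \<le> r C1 + r C2"
    proof -
      have "r A + r (- A) = sum x (UNIV - {a, b})"
        unfolding r_def by (subst sum.union_disjoint[symmetric]) (auto intro!: arg_cong[of _ _ "sum x"])
      also have "\<dots> \<le> sum x (UNIV - {a, b}) + sum x (C1 \<inter> C2 - {a, b})" by simp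
      also have "\<dots> = sum x ((C1 - {a, b}) \<union> (C2 - {a, b})) + sum x ((C1 - {a, b}) \<inter> (C2 - {a, b}))"
        using all by (intro arg_cong2[of _ _ _ _ "(+)"] arg_cong[of _ _ "sum x"]) auto
      also have "\<dots> = r C1 + r C2" unfolding r_def by (rule sum.union_inter) auto
      finally show ?thesis .
    qed
    then show "r A = r C1" "r (- A) = r C2" using C(3)[OF AB(1)] C(4)[OF AB(2)] by linarith+
  qed
  have le: "r C1 \<le> k - 1" "r C2 \<le> k - 1" using single[OF C(2), of u] u C(5) k by linarith+
  \<comment> \<open>Of the total exponent \<open>d + u\<close> at \<open>a\<close> and \<open>b\<close> one unit is discarded and the rest is shared so that
    every optimal cover of either type has weight \<open>k - 1\<close>.\<close>
  define y where "y = x(a := k - 1 - r C1, b := k - 1 - r C2)"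
  have yx: "\<forall>v. v \<noteq> a \<and> v \<noteq> b \<longrightarrow> y v = x v" by (simp add: y_def)
  have yab: "y a = k - 1 - r C1" "y b = k - 1 - r C2" using a_neq_b by (simp_all add: y_def)
  note sp = sum_split_at_leaf[OF yx, folded r_def]
  have weight_a: "sum y D = k - 1 - r C1 + r D" if "cover_a D" for D
    using that sp(1)[of D] yab by (simp add: cover_a_def)
  have weight_b: "sum y D = k - 1 - r C2 + r D" if "cover_b D" for D
    using that sp(2)[of D] yab by (simp add: cover_b_def)
  have "k - 1 \<le> sum y D" if D: "vertex_cover E D" for D
  proof (cases "b \<in> D")
    case False
    then have "cover_a D" using D vertex_cover_edge[OF D ab] by (simp add: cover_a_def)
    then show ?thesis using C(3)[of D] weight_a[of D] by linarith
  next
    case True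
    have "cover_b (D - {a})" using cover_remove_a[OF D True] True a_neq_b by (simp add: cover_b_def)
    then have "k - 1 \<le> sum y (D - {a})" using C(4)[of "D - {a}"] weight_b[of "D - {a}"] by linarith
    also have "\<dots> \<le> sum y D" by (rule sum_mono2) auto
    finally show ?thesis .
  qed
  then obtain w where w: "sum w E = k - 1" "\<And>v. (\<Sum>e\<in>{e \<in> E. v \<in> e}. w e) \<le> y v"
    using koenig[of "k - 1" y] by auto
  note side = card_Int_colour_class[OF A']
  \<comment> \<open>The \<open>k - 1\<close> matched edges use up the weight \<open>k - 1\<close> of each colour class.\<close>
  have perfect: "(\<Sum>e\<in>{e \<in> E. v \<in> e}. w e) = y v" for v
  proof -
    have "(\<Sum>v\<in>A. \<Sum>e\<in>{e \<in> E. v \<in> e}. w e) = sum y A"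
      unfolding sum_incident using w(1) side weight_a[OF AB(1)] rAB le by simp
    moreover have "(\<Sum>v\<in>- A. \<Sum>e\<in>{e \<in> E. v \<in> e}. w e) = sum y (- A)"
      unfolding sum_incident using w(1) side weight_b[OF AB(2)] rAB le by simp
    ultimately show ?thesis using w(2) sum_mono_inv[of "\<lambda>v. \<Sum>e\<in>{e \<in> E. v \<in> e}. w e" _ y v]
      by (cases "v \<in> A") (blast intro: finite)+
  qed
  obtain e where e: "e \<in> inner_edges" "w e = 0"
  proof -
    have "\<exists>e\<in>inner_edges. w e = 0"
    proof (rule ccontr)
      assume "\<not> ?thesis"
      then have "card inner_edges \<le> sum w inner_edges"
        using sum_mono[of inner_edges "\<lambda>_. 1" w] by (simp add: Suc_le_eq)
      also have "\<dots> \<le> sum w E" by (rule sum_mono2) (auto simp: inner_edges_def)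
      finally show False using w(1) k by simp
    qed
    then show ?thesis using that by blast
  qed
  obtain D where D: "vertex_cover E D" "\<forall>p q. {p, q} \<in> E - inner_edges \<longrightarrow> (p \<in> D \<longleftrightarrow> q \<notin> D)"
    "\<not> A \<subseteq> D" "\<not> - A \<subseteq> D" "(\<Sum>e\<in>E. w e * card (e \<inter> D)) = sum w E"
    using unused_edge_gives_cover[of A e w, OF A' e] by (elim exE conjE)
  have wD: "sum y D = k - 1"
    using sum_incident[of w E D] D(5) w(1) unfolding perfect by simp
  have "{a, b} \<in> E - inner_edges" using ab leaf_not_inner by simp
  then have "a \<in> D \<longleftrightarrow> b \<notin> D" using D(2) by blast
  then consider "cover_a D" | "cover_b D" using D(1) by (auto simp: cover_a_def cover_b_def)
  then show False
  proof cases
    case 1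
    then have "r D = r C1" using weight_a wD le by simp
    then show False using top[OF 1 _ AB(2) rAB(2)] D(3) by blast
  next
    case 2
    then have "r D = r C2" using weight_b wD le by simp
    then show False using top[OF AB(1) rAB(1) 2] D(4) by blast
  qed
qed

end

section \<open>Monomial ideals and an upper bound for the depth\<close>

definition monomial_ideal :: "('n \<Rightarrow>\<^sub>0 nat) set \<Rightarrow> ('n, 'k::field) mpoly set" where
  "monomial_ideal Q = {p. Poly_Mapping.keys p \<subseteq> Q}"

definition upward_closed :: "('n \<Rightarrow>\<^sub>0 nat) set \<Rightarrow> bool" where
  "upward_closed Q \<longleftrightarrow> (\<forall>t\<in>Q. \<forall>s. s + t \<in> Q)"

definition restrict_keys :: "'b set \<Rightarrow> ('b \<Rightarrow>\<^sub>0 'c::zero) \<Rightarrow> ('b \<Rightarrow>\<^sub>0 'c)" where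
  "restrict_keys Q p = Poly_Mapping.mapp (\<lambda>t c. c when t \<in> Q) p"

abbreviation var_exp :: "'n \<Rightarrow> ('n \<Rightarrow>\<^sub>0 nat)" where
  "var_exp v \<equiv> Poly_Mapping.single v (Suc 0)"

lemma lookup_restrict_keys:
  "Poly_Mapping.lookup (restrict_keys Q p) t = (Poly_Mapping.lookup p t when t \<in> Q)"
  by (simp add: restrict_keys_def lookup_mapp when_def in_keys_iff)

lemma keys_restrict_keys: "Poly_Mapping.keys (restrict_keys Q p) = Poly_Mapping.keys p \<inter> Q"
  by (auto simp: in_keys_iff lookup_restrict_keys when_def split: if_splits)

lemma restrict_keys_split: "p = restrict_keys Q p + restrict_keys (- Q) (p :: 'b \<Rightarrow>\<^sub>0 'c::comm_monoid_add)"
  by (rule poly_mapping_eqI) (simp add: lookup_add lookup_restrict_keys when_def)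

lemma sum_monomials:
  "p = (\<Sum>t\<in>Poly_Mapping.keys p. Poly_Mapping.single t (Poly_Mapping.lookup p t))"
  for p :: "'b \<Rightarrow>\<^sub>0 'c::comm_monoid_add"
proof (rule poly_mapping_eqI)
  fix k
  show "Poly_Mapping.lookup p k =
    Poly_Mapping.lookup (\<Sum>t\<in>Poly_Mapping.keys p. Poly_Mapping.single t (Poly_Mapping.lookup p t)) k"
    by (simp add: lookup_sum lookup_single when_def in_keys_iff)
qed

lemma keys_multE:
  assumes "t \<in> Poly_Mapping.keys (p * q)"
  obtains s r where "s \<in> Poly_Mapping.keys p" "r \<in> Poly_Mapping.keys q" "t = s + r"
  using keys_mult[of p q] assms by auto

lemma lookup_monomial_mult:
  fixes p :: "('n, 'k::field) mpoly"
  shows "Poly_Mapping.lookup (Poly_Mapping.single s 1 * p) (s + t) = Poly_Mapping.lookup p t"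
proof -
  have "Poly_Mapping.single s 1 * p
    = (\<Sum>r\<in>Poly_Mapping.keys p. Poly_Mapping.single (s + r) (Poly_Mapping.lookup p r))"
    by (subst sum_monomials[of p]) (simp add: sum_distrib_left mult_single)
  then show ?thesis by (simp add: lookup_sum lookup_single when_def in_keys_iff)
qed

lemma lookup_Var_mult: "Poly_Mapping.lookup (Var v * p) (var_exp v + t) = Poly_Mapping.lookup p t"
  using lookup_monomial_mult[of "var_exp v" p t] by (simp add: Var_def)

lemma keys_Var: "Poly_Mapping.keys (Var v :: ('n, 'k::field) mpoly) = {var_exp v}"
  by (simp add: Var_def)

lemma keys_Var_multE:
  fixes p :: "('n, 'k::field) mpoly"
  assumes "t \<in> Poly_Mapping.keys (Var v * p)"
  obtains s where "s \<in> Poly_Mapping.keys p" "t = var_exp v + s"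
  using keys_multE[OF assms] by (auto simp: keys_Var)

lemma monomial_idealI: "(\<And>t. t \<in> Poly_Mapping.keys p \<Longrightarrow> t \<in> Q) \<Longrightarrow> p \<in> monomial_ideal Q"
  by (auto simp: monomial_ideal_def)

lemma monomial_idealD: "p \<in> monomial_ideal Q \<Longrightarrow> t \<notin> Q \<Longrightarrow> Poly_Mapping.lookup p t = 0"
  by (auto simp: monomial_ideal_def in_keys_iff)

lemma upward_closedD: "upward_closed Q \<Longrightarrow> t \<in> Q \<Longrightarrow> s + t \<in> Q"
  by (auto simp: upward_closed_def)

lemma subspace_monomial_ideal:
  assumes "upward_closed Q"
  shows "ideal.subspace (monomial_ideal Q :: ('n, 'k::field) mpoly set)"
proof (rule ideal.subspaceI)
  show "0 \<in> (monomial_ideal Q :: ('n, 'k) mpoly set)" by (simp add: monomial_ideal_def)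
next
  fix p q :: "('n, 'k) mpoly"
  assume "p \<in> monomial_ideal Q" "q \<in> monomial_ideal Q"
  then show "p + q \<in> monomial_ideal Q"
    using keys_add[of p q] by (auto simp: monomial_ideal_def)
next
  fix c p :: "('n, 'k) mpoly"
  assume "p \<in> monomial_ideal Q"
  then show "c * p \<in> monomial_ideal Q"
    using upward_closedD[OF assms] by (intro monomial_idealI) (auto simp: monomial_ideal_def elim!: keys_multE)
qed

lemma span_monomial_ideal:
  "upward_closed Q \<Longrightarrow> ideal.span (monomial_ideal Q) = (monomial_ideal Q :: ('n, 'k::field) mpoly set)"
  by (simp add: ideal.span_eq_iff subspace_monomial_ideal)

lemma in_span_insert: "p \<in> ideal.span (insert f J) \<longleftrightarrow> (\<exists>c. p - c * f \<in> ideal.span J)"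
  by (rule ideal.span_breakdown_eq)

lemma mult_monomial_ideal:
  assumes "\<And>s t. s \<in> Poly_Mapping.keys p \<Longrightarrow> t \<in> Poly_Mapping.keys q \<Longrightarrow> s + t \<in> Q"
  shows "p * q \<in> monomial_ideal Q"
  using assms by (intro monomial_idealI) (auto elim!: keys_multE)

lemma upward_closed_nonzero: "upward_closed (- {0 :: 'a \<Rightarrow>\<^sub>0 nat})"
  unfolding upward_closed_def
  proof (intro ballI allI)
  fix t s :: "'a \<Rightarrow>\<^sub>0 nat" assume "t \<in> - {0}"
  then obtain v where "Poly_Mapping.lookup t v \<noteq> 0" by (metis ComplD poly_mapping_eqI lookup_zero singletonI)
  then have "Poly_Mapping.lookup (s + t) v \<noteq> 0" by (simp add: lookup_add)
  then show "s + t \<in> - {0}" by auto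
  qed

lemma graded_maximal_ideal_no_constant:
  assumes "f \<in> graded_maximal_ideal" shows "0 \<notin> Poly_Mapping.keys f"
proof -
  have ne: "var_exp v \<noteq> (0 :: 'a \<Rightarrow>\<^sub>0 nat)" for v
    by (metis lookup_single_eq lookup_zero nat.distinct(1))
  have "graded_maximal_ideal \<subseteq> (monomial_ideal (- {0}) :: ('a, 'b) mpoly set)"
    unfolding graded_maximal_ideal_def using ne
    by (intro ideal.span_minimal subspace_monomial_ideal upward_closed_nonzero) (auto simp: monomial_ideal_def keys_Var)
  then show ?thesis using assms by (auto simp: monomial_ideal_def)
qed

lemma depth_quotient_ge:
  assumes "set fs \<subseteq> M" "regular_sequence_on_quotient J fs"
  shows "enat (length fs) \<le> depth_quotient M J"
  unfolding depth_quotient_def using assms by (intro SUP_upper) auto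

lemma depth_quotient_le_one:
  assumes "\<And>f g. f \<in> M \<Longrightarrow> g \<in> M \<Longrightarrow> (\<And>h. f * h \<in> ideal.span J \<Longrightarrow> h \<in> ideal.span J) \<Longrightarrow>
    (\<And>h. g * h \<in> ideal.span (insert f J) \<Longrightarrow> h \<in> ideal.span (insert f J)) \<Longrightarrow> False"
  shows "depth_quotient M J \<le> 1"
  unfolding depth_quotient_def
proof (rule SUP_least)
  fix fs assume fs: "fs \<in> {fs. set fs \<subseteq> M \<and> regular_sequence_on_quotient J fs}"
  have "length fs \<le> 1"
  proof (rule ccontr)
    assume "\<not> length fs \<le> 1"
    then obtain f g r where fgr: "fs = f # g # r" by (cases fs; cases "tl fs") auto
    have reg: "\<forall>i<length fs. \<forall>h. fs ! i * h \<in> ideal.span (J \<union> set (take i fs)) \<longrightarrow> h \<in> ideal.span (J \<union> set (take i fs))"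
      using fs by (simp add: regular_sequence_on_quotient_def)
    show False
    proof (rule assms[of f g])
      show "f \<in> M" "g \<in> M" using fs fgr by auto
      show "h \<in> ideal.span J" if "f * h \<in> ideal.span J" for h
        using reg[rule_format, of 0 h] that by (simp add: fgr)
      show "h \<in> ideal.span (insert f J)" if "g * h \<in> ideal.span (insert f J)" for h
        using reg[rule_format, of 1 h] that by (simp add: fgr)
    qed
  qed
  then show "enat (length fs) \<le> 1" by (simp add: one_enat_def)
qed

text \<open>The module interpretation for ideals makes \<open>ideal.scale_scale\<close> a simplifier rule, which regroups
  products against \<open>algebra_simps\<close>; hence its removal.\<close>

lemma split_commutator:
  "(y + y') * (c * x) - (c * y) * (x + x') = c * (x * y') - c * (y * x')" for c x x' y y' :: "'a::comm_ring_1"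
  by (simp add: algebra_simps del: ideal.scale_scale)

lemma split_multiple:
  "x * (c * y') + x * (c * y - z * (y + y')) = (y + y') * (x * (c - z))" for c x y y' z :: "'a::comm_ring_1"
  by (simp add: algebra_simps del: ideal.scale_scale)

text \<open>Let \<open>f, g\<close> be regular, and let \<open>\<phi>\<close> be the homomorphism from the maximal ideal to the quotient that sends
  \<open>x\<^sub>p\<close> to \<open>u x\<^sub>p\<close> for \<open>p \<in> A\<close> and to 0 otherwise. On a polynomial without constant term its value
  is \<open>u\<close> times the part in the variables from \<open>A\<close>, here \<open>U * fA\<close> for \<open>f\<close> and \<open>U * gA\<close> for \<open>g\<close>.
  From \<open>g \<phi>(f) = f \<phi>(g)\<close> regularity gives \<open>\<phi>(f) = c f\<close>, and cancelling \<open>f\<close> in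
  \<open>f \<phi>(x\<^sub>v) = x\<^sub>v \<phi>(f)\<close> gives \<open>\<phi>(x\<^sub>v) = c x\<^sub>v\<close>. Then the coefficient of \<open>u\<close> in \<open>c\<close> is 1 by \<open>v = i\<close>
  and 0 by \<open>v = j\<close>.\<close>

lemma depth_le_one_of_disconnection:
  fixes W :: "('n \<Rightarrow>\<^sub>0 nat) set"
  assumes up: "upward_closed W" and ij: "i \<in> A" "j \<notin> A"
    and mixed: "\<And>p q. p \<in> A \<Longrightarrow> q \<notin> A \<Longrightarrow> u + var_exp p + var_exp q \<in> W"
    and notin: "u + var_exp i \<notin> W" "u + var_exp j \<notin> W"
  shows "depth_quotient graded_maximal_ideal (monomial_ideal W :: ('n, 'k::field) mpoly set) \<le> 1"
proof (rule depth_quotient_le_one)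
  let ?J = "monomial_ideal W :: ('n, 'k) mpoly set"
  fix f g :: "('n, 'k) mpoly"
  assume m: "f \<in> graded_maximal_ideal" "g \<in> graded_maximal_ideal"
    and reg_f: "\<And>h. f * h \<in> ideal.span ?J \<Longrightarrow> h \<in> ideal.span ?J"
    and reg_g: "\<And>h. g * h \<in> ideal.span (insert f ?J) \<Longrightarrow> h \<in> ideal.span (insert f ?J)"
  note J = subspace_monomial_ideal[OF up, where 'k = 'k]
  note spanJ = span_monomial_ideal[OF up, where 'k = 'k]
  define U where "U = (Poly_Mapping.single u 1 :: ('n, 'k) mpoly)"
  define T where "T = {t :: 'n \<Rightarrow>\<^sub>0 nat. Poly_Mapping.keys t \<subseteq> A}"
  define fA fR where "fA = restrict_keys T f" and "fR = restrict_keys (- T) f"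
  define gA gR where "gA = restrict_keys T g" and "gR = restrict_keys (- T) g"
  have f: "f = fA + fR" and g: "g = gA + gR"
    unfolding fA_def fR_def gA_def gR_def by (rule restrict_keys_split)+
  have remove: "\<exists>t'. t = var_exp v + t'" if "v \<in> Poly_Mapping.keys t" for v and t :: "'n \<Rightarrow>\<^sub>0 nat"
    by (rule exI[of _ "Poly_Mapping.update v (Poly_Mapping.lookup t v - 1) t"], rule poly_mapping_eqI)
      (use that in \<open>auto simp: lookup_add lookup_single lookup_update in_keys_iff\<close>)
  have in_A: "\<exists>p\<in>A. \<exists>t'. t = var_exp p + t'"
    if "t \<in> Poly_Mapping.keys (restrict_keys T h)" "h \<in> graded_maximal_ideal" for t and h :: "('n, 'k) mpoly"
  proof -
    have "t \<noteq> 0" "Poly_Mapping.keys t \<subseteq> A"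
      using that graded_maximal_ideal_no_constant[of h] by (auto simp: keys_restrict_keys T_def)
    then obtain v where "v \<in> Poly_Mapping.keys t" "v \<in> A" by (metis keys_eq_empty all_not_in_conv subsetD)
    then show ?thesis using remove by blast
  qed
  have out_A: "\<exists>q\<in>- A. \<exists>t'. t = var_exp q + t'"
    if "t \<in> Poly_Mapping.keys (restrict_keys (- T) h)" for t and h :: "('n, 'k) mpoly"
  proof -
    have "\<not> Poly_Mapping.keys t \<subseteq> A" using that by (auto simp: keys_restrict_keys T_def)
    then show ?thesis using remove by blast
  qed
  have mixedW: "u + (s + t) \<in> W" if st: "\<exists>p\<in>A. \<exists>s'. s = var_exp p + s'" "\<exists>q\<in>- A. \<exists>t'. t = var_exp q + t'" for s t
  proof -
    obtain p s' q t' where "p \<in> A" "q \<notin> A" "s = var_exp p + s'" "t = var_exp q + t'" using st by auto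
    then show ?thesis using upward_closedD[OF up mixed[of p q], of "s' + t'"] by (simp add: algebra_simps)
  qed
  have prod: "U * (restrict_keys T h * restrict_keys (- T) h') \<in> ?J" if "h \<in> graded_maximal_ideal"
    for h h' :: "('n, 'k) mpoly"
    unfolding U_def using mixedW[OF in_A[OF _ that] out_A]
    by (intro mult_monomial_ideal) (auto elim!: keys_multE)
  have "U * (fA * gR) - U * (gA * fR) \<in> ?J"
    using ideal.subspace_diff[OF J prod[OF m(1)] prod[OF m(2)]] unfolding fA_def gA_def fR_def gR_def .
  moreover have "g * (U * fA) - (U * gA) * f = U * (fA * gR) - U * (gA * fR)"
    using split_commutator[of gA gR U fA fR] by (simp only: f[symmetric] g[symmetric])
  ultimately have "g * (U * fA) \<in> ideal.span (insert f ?J)"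
    unfolding in_span_insert spanJ by (intro exI[of _ "U * gA"]) simp
  then have "U * fA \<in> ideal.span (insert f ?J)" by (rule reg_g)
  then obtain c where c: "U * fA - c * f \<in> ?J" unfolding in_span_insert spanJ by blast
  have "Var i * (U - c) \<in> ?J"
  proof -
    have "Var i * (U * fR) \<in> ?J"
    proof (rule mult_monomial_ideal)
      fix s t assume "s \<in> Poly_Mapping.keys (Var i :: ('n, 'k) mpoly)" and t: "t \<in> Poly_Mapping.keys (U * fR)"
      then have s: "s = var_exp i" by (simp add: keys_Var)
      from t obtain t' where t': "t' \<in> Poly_Mapping.keys fR" "t = u + t'" by (auto simp: U_def elim!: keys_multE)
      have "u + (var_exp i + t') \<in> W"
      proof (rule mixedW)
        show "\<exists>p\<in>A. \<exists>s'. var_exp i = var_exp p + s'" using ij(1) by (intro bexI[of _ i] exI[of _ 0]) auto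
        show "\<exists>q\<in>- A. \<exists>t''. t' = var_exp q + t''" using out_A t'(1) unfolding fR_def by blast
      qed
      then show "s + t \<in> W" by (simp add: s t'(2) algebra_simps)
    qed
    then have "Var i * (U * fR) + Var i * (U * fA - c * f) \<in> ?J"
      by (rule ideal.subspace_add[OF J _ ideal.subspace_scale[OF J c]])
    also have "Var i * (U * fR) + Var i * (U * fA - c * f) = f * (Var i * (U - c))"
      using split_multiple[of "Var i" U fR fA c] by (simp only: f[symmetric])
    finally show ?thesis using reg_f unfolding spanJ by blast
  qed
  then have "Poly_Mapping.lookup (Var i * (U - c)) (var_exp i + u) = 0"
    using notin(1) by (intro monomial_idealD) (auto simp: add.commute)
  then have c1: "Poly_Mapping.lookup c u = 1" unfolding lookup_Var_mult by (simp add: lookup_minus U_def)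
  have "Var j * c \<in> ?J"
  proof -
    have "Var j * (U * fA) \<in> ?J"
    proof (rule mult_monomial_ideal)
      fix s t assume "s \<in> Poly_Mapping.keys (Var j :: ('n, 'k) mpoly)" and t: "t \<in> Poly_Mapping.keys (U * fA)"
      then have s: "s = var_exp j" by (simp add: keys_Var)
      from t obtain t' where t': "t' \<in> Poly_Mapping.keys fA" "t = u + t'" by (auto simp: U_def elim!: keys_multE)
      have "u + (t' + var_exp j) \<in> W"
      proof (rule mixedW)
        show "\<exists>q\<in>- A. \<exists>s'. var_exp j = var_exp q + s'" using ij(2) by (intro bexI[of _ j] exI[of _ 0]) auto
        show "\<exists>p\<in>A. \<exists>t''. t' = var_exp p + t''" using in_A[OF _ m(1)] t'(1) unfolding fA_def by blast
      qed
      then show "s + t \<in> W" by (simp add: s t'(2) algebra_simps)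
    qed
    then have "Var j * (U * fA) - Var j * (U * fA - c * f) \<in> ?J"
      by (rule ideal.subspace_diff[OF J _ ideal.subspace_scale[OF J c]])
    also have "Var j * (U * fA) - Var j * (U * fA - c * f) = f * (Var j * c)"
      by (simp add: algebra_simps del: ideal.scale_scale)
    finally show ?thesis using reg_f unfolding spanJ by blast
  qed
  then have "Poly_Mapping.lookup (Var j * c) (var_exp j + u) = 0"
    using notin(2) by (intro monomial_idealD) (auto simp: add.commute)
  then show False using c1 unfolding lookup_Var_mult by simp
qed

section \<open>Regular sequences of linear forms\<close>

lemma exponent_of_max_degree:
  fixes p :: "('n, 'k::field) mpoly"
  assumes "Poly_Mapping.keys p \<noteq> {}"
  shows "\<exists>r\<in>Poly_Mapping.keys p. \<forall>t\<in>Poly_Mapping.keys p. Poly_Mapping.lookup t v \<le> Poly_Mapping.lookup r v"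
proof -
  let ?D = "(\<lambda>t. Poly_Mapping.lookup t v) ` Poly_Mapping.keys p"
  have "Max ?D \<in> ?D" using assms by (intro Max_in) auto
  then obtain r where r: "Max ?D = Poly_Mapping.lookup r v" "r \<in> Poly_Mapping.keys p" by (rule imageE)
  have "Poly_Mapping.lookup t v \<le> Max ?D" if "t \<in> Poly_Mapping.keys p" for t
    using that by (intro Max_ge) auto
  then show ?thesis using r by auto
qed

text \<open>The associated primes of a monomial ideal are generated by variables, and the hypothesis says that none
  of them contains all of \<open>X\<close>; so the sum of \<open>X\<close> avoids them. A direct argument replaces the primes. For
  \<open>v \<in> X\<close> let \<open>Q'\<close> be the localisation of \<open>Q\<close> at \<open>x\<^sub>v\<close>. If \<open>h\<close> had exponents outside \<open>Q'\<close>, take one of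
  maximal \<open>v\<close>-degree among them: multiplying it with \<open>x\<^sub>v\<close> gives a monomial of the product that no other
  term can cancel, so it belongs to \<open>Q'\<close>, and \<open>Q'\<close> is closed under division by \<open>x\<^sub>v\<close>.\<close>

lemma saturated_linear_form_nonzerodivisor:
  fixes X :: "'n::finite set" and h :: "('n, 'k::field) mpoly"
  assumes up: "upward_closed Q"
    and sat: "\<And>t. (\<And>v. v \<in> X \<Longrightarrow> \<exists>s. Poly_Mapping.single v s + t \<in> Q) \<Longrightarrow> t \<in> Q"
    and prod: "(\<Sum>v\<in>X. Var v) * h \<in> monomial_ideal Q"
  shows "h \<in> monomial_ideal Q"
proof (rule monomial_idealI)
  fix t assume t: "t \<in> Poly_Mapping.keys h"
  show "t \<in> Q"
  proof (rule sat)
    fix v assume v: "v \<in> X"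
    define Q' where "Q' = {t. \<exists>s. Poly_Mapping.single v s + t \<in> Q}"
    have up': "upward_closed Q'"
      unfolding upward_closed_def
    proof (intro ballI allI)
      fix t r assume "t \<in> Q'"
      then obtain s where "Poly_Mapping.single v s + t \<in> Q" by (auto simp: Q'_def)
      from upward_closedD[OF up this, of r] have "Poly_Mapping.single v s + (r + t) \<in> Q"
        by (simp add: add.left_commute)
      then show "r + t \<in> Q'" by (auto simp: Q'_def)
    qed
    have QQ': "Q \<subseteq> Q'"
    proof
      fix t assume "t \<in> Q"
      then have "Poly_Mapping.single v 0 + t \<in> Q" by simp
      then show "t \<in> Q'" unfolding Q'_def by blast
    qed
    define L where "L = (\<Sum>v\<in>X. Var v :: ('n, 'k) mpoly)"
    define h2 where "h2 = restrict_keys (- Q') h"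
    have "L * restrict_keys Q' h \<in> monomial_ideal Q'"
      by (intro ideal.subspace_scale subspace_monomial_ideal up' monomial_idealI) (simp add: keys_restrict_keys)
    moreover have "L * h \<in> monomial_ideal Q'" using prod QQ' by (auto simp: L_def monomial_ideal_def)
    ultimately have "L * h - L * restrict_keys Q' h \<in> monomial_ideal Q'"
      by (intro ideal.subspace_diff subspace_monomial_ideal up')
    moreover have "h = restrict_keys Q' h + h2" unfolding h2_def by (rule restrict_keys_split)
    then have "L * h - L * restrict_keys Q' h = L * h2" by (metis add_diff_cancel_left' distrib_left)
    ultimately have Lh2: "L * h2 \<in> monomial_ideal Q'" by simp
    have "Poly_Mapping.keys h2 = {}"
    proof (rule ccontr)
      assume "Poly_Mapping.keys h2 \<noteq> {}"
      note maxdeg = exponent_of_max_degree[OF this, of v]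
      obtain r where r: "r \<in> Poly_Mapping.keys h2"
        and max: "\<And>t. t \<in> Poly_Mapping.keys h2 \<Longrightarrow> Poly_Mapping.lookup t v \<le> Poly_Mapping.lookup r v"
        using maxdeg by (elim bexE) auto
      have other: "Poly_Mapping.lookup (Var w * h2) (var_exp v + r) = 0" if "w \<noteq> v" for w
      proof (rule ccontr)
        assume "Poly_Mapping.lookup (Var w * h2) (var_exp v + r) \<noteq> 0"
        then have "var_exp v + r \<in> Poly_Mapping.keys (Var w * h2)" by (simp add: in_keys_iff)
        then obtain s where s: "s \<in> Poly_Mapping.keys h2" "var_exp v + r = var_exp w + s" by (rule keys_Var_multE)
        from s(2) have "Poly_Mapping.lookup (var_exp v + r) v = Poly_Mapping.lookup (var_exp w + s) v" by simp
        then have "Poly_Mapping.lookup s v = Suc (Poly_Mapping.lookup r v)"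
          using that by (simp add: lookup_add lookup_single)
        then show False using max[OF s(1)] by simp
      qed
      have "Poly_Mapping.lookup (L * h2) (var_exp v + r)
        = (\<Sum>w\<in>X. Poly_Mapping.lookup (Var w * h2) (var_exp v + r))"
        by (simp add: L_def sum_distrib_right lookup_sum)
      also have "\<dots> = (\<Sum>w\<in>{v}. Poly_Mapping.lookup (Var w * h2) (var_exp v + r))"
        using v other by (intro sum.mono_neutral_right) auto
      also have "\<dots> = Poly_Mapping.lookup h2 r" by (simp add: lookup_Var_mult)
      finally have "Poly_Mapping.lookup (L * h2) (var_exp v + r) \<noteq> 0" using r by (simp add: in_keys_iff)
      then have "var_exp v + r \<in> Q'" using monomial_idealD[OF Lh2] by blast
      then obtain s where "Poly_Mapping.single v s + (var_exp v + r) \<in> Q" by (auto simp: Q'_def)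
      then have "Poly_Mapping.single v (Suc s) + r \<in> Q"
        by (simp add: add.assoc[symmetric] single_add[symmetric])
      then have "r \<in> Q'" unfolding Q'_def by blast
      moreover have "r \<notin> Q'" using r by (simp add: h2_def keys_restrict_keys)
      ultimately show False by simp
    qed
    then have "t \<in> Q'" using t by (auto simp: h2_def keys_restrict_keys)
    then show "\<exists>s. Poly_Mapping.single v s + t \<in> Q" by (simp add: Q'_def)
  qed
qed

lemma linear_form_in_maximal: "(\<Sum>v\<in>X. Var v) \<in> graded_maximal_ideal"
  unfolding graded_maximal_ideal_def by (intro ideal.span_sum ideal.span_base) auto

lemma span_with_forms_proper:
  assumes "W \<subseteq> - {0}" "set fs \<subseteq> graded_maximal_ideal"
  shows "ideal.span (monomial_ideal W \<union> set fs) \<noteq> (UNIV :: ('n, 'k::field) mpoly set)"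
proof -
  have up: "upward_closed (- {0 :: 'n \<Rightarrow>\<^sub>0 nat})" by (rule upward_closed_nonzero)
  have "ideal.span (monomial_ideal W \<union> set fs) \<subseteq> monomial_ideal (- {0})"
    using assms graded_maximal_ideal_no_constant
    by (intro ideal.span_minimal subspace_monomial_ideal up) (auto simp: monomial_ideal_def)
  moreover have "(1 :: ('n, 'k) mpoly) \<notin> monomial_ideal (- {0})" by (simp add: monomial_ideal_def)
  ultimately show ?thesis by blast
qed

text \<open>The exponents of the monomials that are congruent up to sign, modulo \<open>x\<^sub>a + x\<^sub>b\<close>, to a monomial
  with exponent in \<open>W\<close>.\<close>

definition identify_vars :: "'n \<Rightarrow> 'n \<Rightarrow> ('n \<Rightarrow>\<^sub>0 nat) set \<Rightarrow> ('n \<Rightarrow>\<^sub>0 nat) set" where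
  "identify_vars a b W = {t. \<exists>s\<in>W. (\<forall>v. v \<noteq> a \<longrightarrow> v \<noteq> b \<longrightarrow> Poly_Mapping.lookup s v = Poly_Mapping.lookup t v) \<and>
     Poly_Mapping.lookup s a + Poly_Mapping.lookup s b = Poly_Mapping.lookup t a + Poly_Mapping.lookup t b}"

context
  fixes a b :: "'n::finite" and W :: "('n \<Rightarrow>\<^sub>0 nat) set"
  assumes ab: "a \<noteq> b" and up: "upward_closed W"
begin

lemma upward_closed_identify_vars: "upward_closed (identify_vars a b W)"
  unfolding upward_closed_def
proof (intro ballI allI)
  fix t r assume "t \<in> identify_vars a b W"
  then obtain s where s: "s \<in> W" "\<forall>v. v \<noteq> a \<longrightarrow> v \<noteq> b \<longrightarrow> Poly_Mapping.lookup s v = Poly_Mapping.lookup t v"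
    "Poly_Mapping.lookup s a + Poly_Mapping.lookup s b = Poly_Mapping.lookup t a + Poly_Mapping.lookup t b"
    by (auto simp: identify_vars_def)
  then show "r + t \<in> identify_vars a b W" 
    using upward_closedD[OF up s(1), of r] unfolding identify_vars_def
    by (intro CollectI bexI[of _ "r + s"]) (simp_all add: lookup_add)
qed

lemma subset_identify_vars: "W \<subseteq> identify_vars a b W"
  by (auto simp: identify_vars_def)

lemma identify_vars_swap: "var_exp a + t \<in> identify_vars a b W \<longleftrightarrow> var_exp b + t \<in> identify_vars a b W"
  using ab by (simp add: identify_vars_def lookup_add lookup_single when_def)

definition "ab_form = (\<Sum>v\<in>{a, b}. Var v :: ('n, 'k::field) mpoly)"

lemma ab_form: "ab_form = Var a + Var b" using ab by (simp add: ab_form_def)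

lemma ab_form_mult_single:
  "ab_form * Poly_Mapping.single t c = Poly_Mapping.single (var_exp a + t) c + Poly_Mapping.single (var_exp b + t) c"
  by (simp add: ab_form Var_def distrib_right mult_single)

lemma lookup_decompose:
  "t = Poly_Mapping.single a (Poly_Mapping.lookup t a) + Poly_Mapping.update a 0 t" for t :: "'n \<Rightarrow>\<^sub>0 nat"
  by (rule poly_mapping_eqI) (simp add: lookup_add lookup_single lookup_update when_def)

lemma monomial_in_ideal_swap:
  assumes S: "ideal.subspace S" and f: "(ab_form :: ('n, 'k::field) mpoly) \<in> S"
  shows "(\<forall>c. Poly_Mapping.single (Poly_Mapping.single a i + t) c \<in> S) \<longleftrightarrow>
    (\<forall>c. Poly_Mapping.single (Poly_Mapping.single b i + t) (c :: 'k) \<in> S)"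
proof (induction i arbitrary: t)
  case (Suc i)
  have step: "(\<forall>c. Poly_Mapping.single (var_exp a + t) c \<in> S) \<longleftrightarrow> (\<forall>c. Poly_Mapping.single (var_exp b + t) (c :: 'k) \<in> S)" for t
  proof -
    have sum: "Poly_Mapping.single (var_exp a + t) c + Poly_Mapping.single (var_exp b + t) (c :: 'k) \<in> S" for c
      using ideal.subspace_scale[OF S f, of "Poly_Mapping.single t c"]
      by (simp add: ab_form_mult_single[symmetric] mult.commute)
    show ?thesis
      using ideal.subspace_diff[OF S sum] by (metis add_diff_cancel_left' add_diff_cancel_right')
  qed
  have "Poly_Mapping.single a (Suc i) + t = Poly_Mapping.single a i + (var_exp a + t)"
    "Poly_Mapping.single b (Suc i) + t = var_exp b + (Poly_Mapping.single b i + t)"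
    by (simp_all add: single_add[symmetric] add.assoc[symmetric])
  then show ?case using Suc.IH[of "var_exp a + t"] step[of "Poly_Mapping.single b i + t"]
    by (simp add: add.left_commute)
qed simp

lemma monomial_ideal_identify_vars_subset:
  "monomial_ideal (identify_vars a b W) \<subseteq> ideal.span (insert ab_form (monomial_ideal W) :: ('n, 'k::field) mpoly set)"
proof
  let ?S = "ideal.span (insert ab_form (monomial_ideal W) :: ('n, 'k) mpoly set)"
  have f: "ab_form \<in> ?S" by (intro ideal.span_base) simp
  note swap = monomial_in_ideal_swap[OF ideal.subspace_span f]
  fix p :: "('n, 'k) mpoly" assume p: "p \<in> monomial_ideal (identify_vars a b W)"
  have "Poly_Mapping.single t c \<in> ?S" if t: "t \<in> identify_vars a b W" for t c
  proof -
    obtain s where s: "s \<in> W" "\<forall>v. v \<noteq> a \<longrightarrow> v \<noteq> b \<longrightarrow> Poly_Mapping.lookup s v = Poly_Mapping.lookup t v"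
      "Poly_Mapping.lookup s a + Poly_Mapping.lookup s b = Poly_Mapping.lookup t a + Poly_Mapping.lookup t b"
      using t by (auto simp: identify_vars_def)
    have eq: "Poly_Mapping.single b (Poly_Mapping.lookup s a) + Poly_Mapping.update a 0 s =
      Poly_Mapping.single b (Poly_Mapping.lookup t a) + Poly_Mapping.update a 0 t"
      using s ab by (intro poly_mapping_eqI) (auto simp: lookup_add lookup_single lookup_update when_def)
    have "\<forall>c. Poly_Mapping.single s c \<in> ?S"
      using s(1) by (auto intro!: ideal.span_base monomial_idealI split: if_splits)
    then show ?thesis
      using swap[of "Poly_Mapping.lookup s a" "Poly_Mapping.update a 0 s"]
        swap[of "Poly_Mapping.lookup t a" "Poly_Mapping.update a 0 t"]
      unfolding lookup_decompose[symmetric] eq by blast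
  qed
  then have "(\<Sum>t\<in>Poly_Mapping.keys p. Poly_Mapping.single t (Poly_Mapping.lookup p t)) \<in> ?S"
    using p by (intro ideal.span_sum) (auto simp: monomial_ideal_def)
  then show "p \<in> ?S" by (simp only: sum_monomials[symmetric])
qed

lemma eliminate_variable:
  "\<exists>h'. (\<forall>t\<in>Poly_Mapping.keys h'. Poly_Mapping.lookup t a = 0) \<and> h - h' \<in> ideal.span {ab_form :: ('n, 'k::field) mpoly}"
proof -
  let ?S = "ideal.span {ab_form :: ('n, 'k) mpoly}"
  define R where "R h \<longleftrightarrow> (\<exists>h'. (\<forall>t\<in>Poly_Mapping.keys h'. Poly_Mapping.lookup t a = 0) \<and> h - h' \<in> ?S)" for h
  have add: "R (h + k)" if hk: "R h" "R k" for h k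
  proof -
    obtain h' k' where h: "\<forall>t\<in>Poly_Mapping.keys h'. Poly_Mapping.lookup t a = 0" "h - h' \<in> ?S"
      and k: "\<forall>t\<in>Poly_Mapping.keys k'. Poly_Mapping.lookup t a = 0" "k - k' \<in> ?S"
      using hk unfolding R_def by blast
    have "(h + k) - (h' + k') \<in> ?S" using ideal.span_add[OF h(2) k(2)] by (simp add: add_diff_add)
    then show ?thesis unfolding R_def using h(1) k(1) keys_add[of h' k'] by (intro exI[of _ "h' + k'"]) blast
  qed
  have mono: "R (Poly_Mapping.single (Poly_Mapping.single a i + t) c)" if "Poly_Mapping.lookup t a = 0" for i t c
    using that
  proof (induction i arbitrary: t c)
    case 0
    then show ?case unfolding R_def
      by (intro exI[of _ "Poly_Mapping.single t c"]) (auto simp: ideal.span_zero split: if_splits)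
  next
    case (Suc i)
    let ?t = "Poly_Mapping.single a i + t"
    have "R (Poly_Mapping.single (Poly_Mapping.single a i + (var_exp b + t)) (- c))"
      using Suc.prems ab by (intro Suc.IH) (simp add: lookup_add lookup_single)
    moreover have "R (ab_form * Poly_Mapping.single ?t c)"
      unfolding R_def
    proof (intro exI[of _ 0] conjI)
      have "Poly_Mapping.single ?t c * ab_form \<in> ?S" by (intro ideal.span_scale ideal.span_base) simp
      then show "ab_form * Poly_Mapping.single ?t c - 0 \<in> ?S" by (simp add: mult.commute)
    qed simp
    ultimately have "R (ab_form * Poly_Mapping.single ?t c + Poly_Mapping.single (Poly_Mapping.single a i + (var_exp b + t)) (- c))"
      using add by blast
    also have "ab_form * Poly_Mapping.single ?t c + Poly_Mapping.single (Poly_Mapping.single a i + (var_exp b + t)) (- c)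
      = Poly_Mapping.single (var_exp a + ?t) c"
      by (simp add: ab_form_mult_single single_uminus add.left_commute)
    also have "var_exp a + ?t = Poly_Mapping.single a (Suc i) + t"
      by (simp add: single_add[symmetric] add.assoc[symmetric])
    finally show ?case .
  qed
  have single: "R (Poly_Mapping.single t c)" for t c
    using mono[of "Poly_Mapping.update a 0 t" "Poly_Mapping.lookup t a" c]
    unfolding lookup_decompose[symmetric] by (simp add: lookup_update)
  have zero: "R 0" unfolding R_def by (intro exI[of _ 0]) (simp add: ideal.span_zero)
  have "R (\<Sum>t\<in>F. Poly_Mapping.single t (Poly_Mapping.lookup h t))" if "finite F" for F
    using that by (induction F) (simp_all add: add single zero)
  from this[of "Poly_Mapping.keys h"] have "R h" by (simp only: sum_monomials[symmetric] finite_keys simp_thms)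
  then show ?thesis by (simp add: R_def)
qed

text \<open>Among the polynomials without \<open>x\<^sub>a\<close>, adding \<open>x\<^sub>a + x\<^sub>b\<close> to the ideal brings in nothing new. In
  \<open>p = q + k (x\<^sub>a + x\<^sub>b)\<close> all terms of \<open>k\<close> that are carried into the monomial ideal may be moved to \<open>q\<close>;
  membership is the same for multiplication with \<open>x\<^sub>a\<close> and with \<open>x\<^sub>b\<close>. A remaining term of maximal
  \<open>a\<close>-degree would leave a multiple of \<open>x\<^sub>a\<close> in \<open>p\<close>.\<close>

lemma eliminated_in_monomial_ideal:
  fixes p :: "('n, 'k::field) mpoly"
  assumes free: "\<And>t. t \<in> Poly_Mapping.keys p \<Longrightarrow> Poly_Mapping.lookup t a = 0"
    and p: "p \<in> ideal.span (insert ab_form (monomial_ideal (identify_vars a b W)))"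
  shows "p \<in> monomial_ideal (identify_vars a b W)"
proof -
  let ?Q = "identify_vars a b W"
  note upQ = upward_closed_identify_vars
  note J = subspace_monomial_ideal[OF upQ, where 'k = 'k]
  obtain k where k: "p - k * ab_form \<in> monomial_ideal ?Q"
    using p unfolding in_span_insert span_monomial_ideal[OF upQ] by blast
  define T where "T = {t. var_exp a + t \<in> ?Q}"
  define r where "r = restrict_keys (- T) k"
  have kr: "k = restrict_keys T k + r" unfolding r_def by (rule restrict_keys_split)
  have "restrict_keys T k * ab_form \<in> monomial_ideal ?Q"
  proof (rule mult_monomial_ideal)
    fix s t assume "s \<in> Poly_Mapping.keys (restrict_keys T k)" "t \<in> Poly_Mapping.keys (ab_form :: ('n, 'k) mpoly)"
    then have "var_exp a + s \<in> ?Q" "t = var_exp a \<or> t = var_exp b"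
      using keys_add[of "Var a :: ('n, 'k) mpoly" "Var b"] by (auto simp: keys_restrict_keys T_def ab_form keys_Var)
    then show "s + t \<in> ?Q" using identify_vars_swap[of s] by (auto simp: add.commute)
  qed
  from ideal.subspace_add[OF J k this]
  have "p - (k - restrict_keys T k) * ab_form \<in> monomial_ideal ?Q" by (simp add: left_diff_distrib diff_diff_eq2 add_diff_eq diff_add_eq)
  moreover have "k - restrict_keys T k = r" using kr by (metis add_diff_cancel_left')
  ultimately have pr: "p - r * ab_form \<in> monomial_ideal ?Q" by simp
  have "Poly_Mapping.keys r = {}"
  proof (rule ccontr)
    assume "Poly_Mapping.keys r \<noteq> {}"
    note maxdeg = exponent_of_max_degree[OF this, of a]
      obtain t where t: "t \<in> Poly_Mapping.keys r"
        and max: "\<And>s. s \<in> Poly_Mapping.keys r \<Longrightarrow> Poly_Mapping.lookup s a \<le> Poly_Mapping.lookup t a"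
        using maxdeg by (elim bexE) auto
    have "var_exp a + t \<notin> ?Q" using t by (simp add: r_def keys_restrict_keys T_def)
    then have "Poly_Mapping.lookup (p - r * ab_form) (var_exp a + t) = 0" using monomial_idealD[OF pr] by blast
    moreover have "Poly_Mapping.lookup p (var_exp a + t) = 0"
      using free[of "var_exp a + t"] by (auto simp: in_keys_iff lookup_add)
    moreover have "Poly_Mapping.lookup (Var b * r) (var_exp a + t) = 0"
    proof (rule ccontr)
      assume "Poly_Mapping.lookup (Var b * r) (var_exp a + t) \<noteq> 0"
      then have "var_exp a + t \<in> Poly_Mapping.keys (Var b * r)" by (simp add: in_keys_iff)
      then obtain s where s: "s \<in> Poly_Mapping.keys r" "var_exp a + t = var_exp b + s" by (rule keys_Var_multE)
      from s(2) have "Poly_Mapping.lookup (var_exp a + t) a = Poly_Mapping.lookup (var_exp b + s) a" by simp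
      then have "Poly_Mapping.lookup s a = Suc (Poly_Mapping.lookup t a)"
        using ab by (simp add: lookup_add lookup_single)
      then show False using max[OF s(1)] by simp
    qed
    moreover have "r * ab_form = Var a * r + Var b * r" by (simp add: ab_form distrib_left mult.commute)
    ultimately have "Poly_Mapping.lookup r t = 0" by (simp add: lookup_minus lookup_add lookup_Var_mult)
    then show False using t by (simp add: in_keys_iff)
  qed
  then have "r = 0" by (metis lookup_zero not_in_keys_iff_lookup_eq_zero empty_iff poly_mapping_eqI)
  then show ?thesis using pr by simp
qed

lemma depth_ge_one:
  assumes W: "W \<subseteq> - {0}"
    and sat: "\<And>t. (\<And>v. v \<in> {a, b} \<Longrightarrow> \<exists>s. Poly_Mapping.single v s + t \<in> W) \<Longrightarrow> t \<in> W"
  shows "1 \<le> depth_quotient graded_maximal_ideal (monomial_ideal W :: ('n, 'k::field) mpoly set)"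
proof -
  let ?f = "ab_form :: ('n, 'k) mpoly"
  have m: "set [?f] \<subseteq> graded_maximal_ideal" by (simp add: ab_form_def linear_form_in_maximal)
  have "h \<in> monomial_ideal W" if "?f * h \<in> monomial_ideal W" for h
    using that unfolding ab_form_def by (rule saturated_linear_form_nonzerodivisor[OF up sat, rotated])
  then have "regular_sequence_on_quotient (monomial_ideal W) [?f]"
    unfolding regular_sequence_on_quotient_def
    using span_with_forms_proper[OF W m] by (auto simp: span_monomial_ideal[OF up])
  from depth_quotient_ge[OF m this] show ?thesis by (simp add: one_enat_def)
qed

text \<open>The sequence is \<open>x\<^sub>a + x\<^sub>b\<close> followed by the sum of the variables other than \<open>x\<^sub>a\<close>. For the second
  step, elements of the quotient are represented without \<open>x\<^sub>a\<close>, where the ideal is the monomial ideal of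
  \<open>identify_vars a b W\<close>.\<close>

lemma depth_ge_two:
  assumes W: "W \<subseteq> - {0}"
    and sat: "\<And>t. (\<And>v. v \<in> {a, b} \<Longrightarrow> \<exists>s. Poly_Mapping.single v s + t \<in> W) \<Longrightarrow> t \<in> W"
    and sat': "\<And>t. (\<And>v. v \<in> - {a} \<Longrightarrow> \<exists>s. Poly_Mapping.single v s + t \<in> identify_vars a b W) \<Longrightarrow>
      t \<in> identify_vars a b W"
  shows "2 \<le> depth_quotient graded_maximal_ideal (monomial_ideal W :: ('n, 'k::field) mpoly set)"
proof -
  let ?f = "ab_form :: ('n, 'k) mpoly"
  let ?g = "(\<Sum>v\<in>- {a}. Var v) :: ('n, 'k) mpoly"
  let ?Q = "identify_vars a b W"
  let ?S = "ideal.span (insert ?f (monomial_ideal W))"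
  have m: "set [?f, ?g] \<subseteq> graded_maximal_ideal" by (simp add: ab_form_def linear_form_in_maximal)
  have reg_f: "h \<in> monomial_ideal W" if "?f * h \<in> monomial_ideal W" for h
    using that unfolding ab_form_def by (rule saturated_linear_form_nonzerodivisor[OF up sat, rotated])
  have reg_g: "h \<in> ?S" if gh: "?g * h \<in> ?S" for h
  proof -
    obtain h' where free: "\<forall>t\<in>Poly_Mapping.keys h'. Poly_Mapping.lookup t a = 0" and h': "h - h' \<in> ideal.span {?f}"
      using eliminate_variable by blast
    have hS: "h - h' \<in> ?S" using h' ideal.span_mono[of "{?f}" "insert ?f (monomial_ideal W)"] by blast
    have "?g * h - ?g * (h - h') \<in> ?S" by (rule ideal.span_diff[OF gh ideal.span_scale[OF hS]])
    then have "?g * h' \<in> ?S" by (simp add: right_diff_distrib)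
    moreover have "?S \<subseteq> ideal.span (insert ?f (monomial_ideal ?Q))"
      using subset_identify_vars by (intro ideal.span_mono) (auto simp: monomial_ideal_def)
    ultimately have gh': "?g * h' \<in> ideal.span (insert ?f (monomial_ideal ?Q))" by blast
    have "?g * h' \<in> monomial_ideal ?Q"
    proof (rule eliminated_in_monomial_ideal[OF _ gh'])
      fix t assume "t \<in> Poly_Mapping.keys (?g * h')"
      then obtain s r where sr: "s \<in> Poly_Mapping.keys ?g" "r \<in> Poly_Mapping.keys h'" "t = s + r" by (rule keys_multE)
      then have "Poly_Mapping.lookup ?g s \<noteq> 0" by (simp add: in_keys_iff)
      then have "\<exists>v\<in>- {a}. Poly_Mapping.lookup (Var v :: ('n, 'k) mpoly) s \<noteq> 0"
        unfolding lookup_sum using sum.neutral by metis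
      then obtain v where "v \<noteq> a" "s = var_exp v" by (auto simp: Var_def lookup_single when_def split: if_splits)
      then show "Poly_Mapping.lookup t a = 0" using sr free by (simp add: lookup_add lookup_single)
    qed
    then have "h' \<in> monomial_ideal ?Q"
      by (rule saturated_linear_form_nonzerodivisor[OF upward_closed_identify_vars sat', rotated])
    then have "h' \<in> ?S" using monomial_ideal_identify_vars_subset by blast
    then show ?thesis using ideal.span_add[OF hS] by force
  qed
  have "regular_sequence_on_quotient (monomial_ideal W) [?f, ?g]"
    unfolding regular_sequence_on_quotient_def
  proof (intro conjI allI impI)
    fix i h assume i: "i < length [?f, ?g]" and h: "[?f, ?g] ! i * h \<in> ideal.span (monomial_ideal W \<union> set (take i [?f, ?g]))"
    show "h \<in> ideal.span (monomial_ideal W \<union> set (take i [?f, ?g]))"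
    proof (cases i)
      case 0
      then show ?thesis using h reg_f[of h] by (simp add: span_monomial_ideal[OF up])
    next
      case (Suc j)
      then have "i = 1" using i by simp
      then show ?thesis using h reg_g[of h] by simp
    qed
  qed (rule span_with_forms_proper[OF W m])
  from depth_quotient_ge[OF m this] show ?thesis by (simp add: numeral_eq_enat numeral_2_eq_2)
qed

end

section \<open>Powers of the edge ideal of a tree\<close>

definition cover_exponents :: "'v set set \<Rightarrow> nat \<Rightarrow> ('v \<Rightarrow>\<^sub>0 nat) set" where
  "cover_exponents E k = {t. \<forall>C. vertex_cover E C \<longrightarrow> k \<le> sum (Poly_Mapping.lookup t) C}"

lemma sum_lookup_add:
  "sum (Poly_Mapping.lookup (s + t)) C = sum (Poly_Mapping.lookup s) C + sum (Poly_Mapping.lookup t) C"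
  by (simp add: lookup_add sum.distrib)

lemma sum_lookup_single:
  fixes v :: "'v::finite"
  shows "sum (Poly_Mapping.lookup (Poly_Mapping.single v s)) C = (if v \<in> C then s else 0)"
  by (simp add: lookup_single when_def)

lemma lookup_Abs_finite: "Poly_Mapping.lookup (Abs_poly_mapping f) = f" for f :: "'v::finite \<Rightarrow> nat"
  by (rule lookup_Abs_poly_mapping) simp

lemma upward_closed_cover_exponents: "upward_closed (cover_exponents E k)"
  unfolding upward_closed_def cover_exponents_def by (auto simp: sum_lookup_add trans_le_add2)

context tree_graph
begin

lemma cover_exponents_nonzero: "1 \<le> k \<Longrightarrow> cover_exponents E k \<subseteq> - {0}"
proof -
  assume k: "1 \<le> k"
  have "vertex_cover E UNIV" using edge_pair unfolding vertex_cover_def by fastforce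
  then show ?thesis using k by (auto simp: cover_exponents_def)
qed

lemma size_le_cover_weight:
  fixes w :: "'v set \<Rightarrow> nat"
  assumes "vertex_cover E C" "F \<subseteq> E"
  shows "sum w F \<le> (\<Sum>e\<in>F. w e * card (e \<inter> C))"
proof (rule sum_mono)
  fix e assume "e \<in> F"
  then have "e \<inter> C \<noteq> {}" using assms by (auto simp: vertex_cover_def)
  then have "1 \<le> card (e \<inter> C)" by (simp add: Suc_le_eq card_gt_0_iff)
  then show "w e \<le> w e * card (e \<inter> C)" using mult_le_mono2[of 1 "card (e \<inter> C)" "w e"] by simp
qed

text \<open>A matching of size \<open>k + 1\<close> below \<open>t\<close> contains some edge; after its removal the remaining matching
  of size \<open>k\<close> bounds the weight of every cover from below.\<close>

lemma cover_exponents_Suc: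
  assumes "t \<in> cover_exponents E (Suc k)"
  shows "\<exists>i j t'. {i, j} \<in> E \<and> t = var_exp i + var_exp j + t' \<and> t' \<in> cover_exponents E k"
proof -
  let ?x = "Poly_Mapping.lookup t"
  obtain w where w: "sum w E = Suc k" "\<forall>v. (\<Sum>e\<in>{e \<in> E. v \<in> e}. w e) \<le> ?x v"
    using koenig[of "Suc k" ?x] assms by (auto simp: cover_exponents_def)
  obtain e where e: "e \<in> E" "w e \<noteq> 0" using w(1) by (metis sum.neutral nat.distinct(1))
  from edge_pair[OF e(1)] obtain i j where ij: "e = {i, j}" "i \<noteq> j" by (elim exE conjE)
  have pos: "1 \<le> ?x v" if "v \<in> e" for v
  proof -
    have "w e \<le> (\<Sum>e\<in>{e \<in> E. v \<in> e}. w e)" using e(1) that by (intro member_le_sum) auto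
    then show ?thesis using w(2)[rule_format, of v] e(2) by linarith
  qed
  define t' where "t' = Abs_poly_mapping (\<lambda>v. ?x v - (if v \<in> e then 1 else 0))"
  have t: "t = var_exp i + var_exp j + t'"
    using pos[of i] pos[of j] ij
    by (intro poly_mapping_eqI) (auto simp: lookup_add lookup_single t'_def lookup_Abs_finite when_def)
  have "k \<le> sum (Poly_Mapping.lookup t') C" if C: "vertex_cover E C" for C
  proof -
    have "sum ?x C = card (e \<inter> C) + sum (Poly_Mapping.lookup t') C"
      using ij by (subst t) (auto simp: sum_lookup_add sum_lookup_single)
    moreover have "(\<Sum>e\<in>E. w e * card (e \<inter> C)) \<le> sum ?x C"
      unfolding sum_incident[symmetric] using w(2) by (intro sum_mono) simp
    moreover have "(\<Sum>f\<in>E. w f * card (f \<inter> C)) = w e * card (e \<inter> C) + (\<Sum>f\<in>E - {e}. w f * card (f \<inter> C))"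
      using e(1) by (intro sum.remove) auto
    moreover have "sum w (E - {e}) \<le> (\<Sum>f\<in>E - {e}. w f * card (f \<inter> C))"
      by (rule size_le_cover_weight[OF C]) auto
    moreover have "sum w E = w e + sum w (E - {e})" using e(1) by (intro sum.remove) auto
    moreover have "w e - 1 + card (e \<inter> C) \<le> w e * card (e \<inter> C)"
    proof -
      have "e \<inter> C \<noteq> {}" using C e(1) by (auto simp: vertex_cover_def)
      then have "card (e \<inter> C) \<noteq> 0" by simp
      then obtain c where c: "card (e \<inter> C) = Suc c" using not0_implies_Suc by blast
      obtain d where d: "w e = Suc d" using e(2) not0_implies_Suc by blast
      show ?thesis unfolding c d by simp
    qed
    ultimately show ?thesis using w(1) e(2) by linarith
  qed
  then have "t' \<in> cover_exponents E k" by (simp add: cover_exponents_def)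
  then show ?thesis using t e(1) ij(1) by blast
qed

lemma edge_ideal_power:
  "ideal_power (edge_ideal E) k = (monomial_ideal (cover_exponents E k) :: ('v, 'k::field) mpoly set)"
proof (induction k)
  case 0
  show ?case by (simp add: cover_exponents_def monomial_ideal_def)
next
  case (Suc k)
  let ?I = "edge_ideal E :: ('v, 'k) mpoly set"
  let ?P = "{p * q | p q. p \<in> ?I \<and> q \<in> ideal_power ?I k}"
  note J = subspace_monomial_ideal[OF upward_closed_cover_exponents, where 'k = 'k]
  have I1: "?I \<subseteq> monomial_ideal (cover_exponents E 1)"
    unfolding edge_ideal_def
  proof (rule ideal.span_minimal[OF _ J], clarify, rule mult_monomial_ideal)
    fix i j s t assume ij: "{i, j} \<in> E" and "s \<in> Poly_Mapping.keys (Var i :: ('v, 'k) mpoly)"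
      "t \<in> Poly_Mapping.keys (Var j :: ('v, 'k) mpoly)"
    then have st: "s = var_exp i" "t = var_exp j" by (simp_all add: keys_Var)
    have "1 \<le> sum (Poly_Mapping.lookup (var_exp i + var_exp j)) C" if "vertex_cover E C" for C
      using vertex_cover_edge[OF that ij] by (auto simp: sum_lookup_add sum_lookup_single)
    then show "s + t \<in> cover_exponents E 1" by (simp add: st cover_exponents_def)
  qed
  have "ideal.span ?P \<subseteq> monomial_ideal (cover_exponents E (Suc k))"
  proof (rule ideal.span_minimal[OF _ J], clarify, rule mult_monomial_ideal)
    fix p q :: "('v, 'k) mpoly" and s t
    assume "p \<in> ?I" "q \<in> ideal_power ?I k" "s \<in> Poly_Mapping.keys p" "t \<in> Poly_Mapping.keys q"
    then have s: "s \<in> cover_exponents E 1" and t: "t \<in> cover_exponents E k"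
      using I1 unfolding Suc.IH by (auto simp: monomial_ideal_def)
    have "Suc k \<le> sum (Poly_Mapping.lookup (s + t)) C" if "vertex_cover E C" for C
    proof -
      have "1 \<le> sum (Poly_Mapping.lookup s) C" "k \<le> sum (Poly_Mapping.lookup t) C"
        using s t that by (auto simp: cover_exponents_def)
      then show ?thesis by (simp add: sum_lookup_add)
    qed
    then show "s + t \<in> cover_exponents E (Suc k)" by (simp add: cover_exponents_def)
  qed
  moreover have "monomial_ideal (cover_exponents E (Suc k)) \<subseteq> ideal.span ?P"
  proof
    fix p :: "('v, 'k) mpoly" assume p: "p \<in> monomial_ideal (cover_exponents E (Suc k))"
    have "Poly_Mapping.single t c \<in> ideal.span ?P" if t: "t \<in> cover_exponents E (Suc k)" for t and c :: 'k
    proof -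
      from cover_exponents_Suc[OF t] obtain i j t' where ij: "{i, j} \<in> E" "t = var_exp i + var_exp j + t'"
        "t' \<in> cover_exponents E k" by (elim exE conjE)
      have "Poly_Mapping.single t c = (Var i * Var j) * Poly_Mapping.single t' c"
        by (simp add: ij(2) Var_def mult_single)
      moreover have "Var i * Var j \<in> ?I" unfolding edge_ideal_def using ij(1) by (intro ideal.span_base) blast
      moreover have "Poly_Mapping.single t' c \<in> ideal_power ?I k"
        unfolding Suc.IH using ij(3) by (auto simp: monomial_ideal_def)
      ultimately show ?thesis by (intro ideal.span_base) blast
    qed
    then have "(\<Sum>t\<in>Poly_Mapping.keys p. Poly_Mapping.single t (Poly_Mapping.lookup p t)) \<in> ideal.span ?P"
      using p by (intro ideal.span_sum) (auto simp: monomial_ideal_def)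
    then show "p \<in> ideal.span ?P" by (simp only: sum_monomials[symmetric])
  qed
  ultimately show ?case by simp
qed

text \<open>The exponent \<open>u\<close> is that of the product of the edges with multiplicity \<open>w\<close>: each inner edge once, and
  one arbitrary edge \<open>e0\<close> repeated to reach \<open>k - 1\<close> factors. A cover that contains an inner edge
  has \<open>u\<close>-weight at least \<open>k\<close>; any other cover has weight at least \<open>k - 1\<close> and meets \<open>{p, q}\<close>.\<close>

lemma depth_high_power_le_one:
  assumes E: "E \<noteq> {}" and k: "Suc (card inner_edges) \<le> k"
  shows "depth_quotient graded_maximal_ideal (monomial_ideal (cover_exponents E k) :: ('v, 'k::field) mpoly set) \<le> 1"
proof -
  obtain A :: "'v set" where A: "colour_class A" using bipartition by blast
  obtain e0 where e0: "e0 \<in> E" using E by blast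
  define w where "w e = (if e \<in> inner_edges then 1 else 0) + (if e = e0 then k - 1 - card inner_edges else 0)" for e
  have "sum w E = card (E \<inter> inner_edges) + (k - 1 - card inner_edges)"
    using e0 by (simp add: w_def sum.distrib flip: sum.inter_restrict)
  moreover have "E \<inter> inner_edges = inner_edges" by (auto simp: inner_edges_def)
  ultimately have wE: "sum w E = k - 1" using k by simp
  define u where "u = Abs_poly_mapping (\<lambda>v. \<Sum>e\<in>{e \<in> E. v \<in> e}. w e)"
  have u: "sum (Poly_Mapping.lookup u) C = (\<Sum>e\<in>E. w e * card (e \<inter> C))" for C
    unfolding u_def lookup_Abs_finite by (rule sum_incident)
  have side: "sum (Poly_Mapping.lookup u) A = k - 1" "sum (Poly_Mapping.lookup u) (- A) = k - 1"
    unfolding u using wE card_Int_colour_class[OF A] by simp_all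
  obtain i j where ij: "i \<in> A" "j \<notin> A"
  proof -
    have "card (e0 \<inter> A) \<noteq> 0" "card (e0 \<inter> - A) \<noteq> 0" using card_Int_colour_class[OF A e0] by simp_all
    then have "e0 \<inter> A \<noteq> {}" "e0 \<inter> - A \<noteq> {}" by auto
    then show ?thesis using that by blast
  qed
  show ?thesis
  proof (rule depth_le_one_of_disconnection[OF upward_closed_cover_exponents ij])
    fix p q assume pq: "p \<in> A" "q \<notin> A"
    have "k \<le> sum (Poly_Mapping.lookup (u + var_exp p + var_exp q)) C" if C: "vertex_cover E C" for C
    proof (cases "\<exists>e\<in>inner_edges. e \<subseteq> C")
      case True
      then obtain e where e: "e \<in> inner_edges" "e \<subseteq> C" by blast
      then have eE: "e \<in> E" by (simp add: inner_edges_def)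
      from edge_pair[OF eE] have "card e = 2" by auto
      moreover have "e \<inter> C = e" using e(2) by blast
      ultimately have "w e * card (e \<inter> C) \<ge> Suc (w e)" using e(1) by (simp add: w_def)
      moreover have "(\<Sum>f\<in>E. w f * card (f \<inter> C)) = w e * card (e \<inter> C) + (\<Sum>f\<in>E - {e}. w f * card (f \<inter> C))"
        using eE by (intro sum.remove) auto
      moreover have "sum w (E - {e}) \<le> (\<Sum>f\<in>E - {e}. w f * card (f \<inter> C))"
        by (rule size_le_cover_weight[OF C]) auto
      moreover have "sum w E = w e + sum w (E - {e})" using eE by (intro sum.remove) auto
      ultimately have "k \<le> sum (Poly_Mapping.lookup u) C" using wE k unfolding u by linarith
      then show ?thesis by (simp add: sum_lookup_add)
    next
      case False
      then have "p \<in> C \<or> q \<in> C" using tight_cover_meets[OF A C _ pq] by blast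
      moreover have "k - 1 \<le> sum (Poly_Mapping.lookup u) C"
        using size_le_cover_weight[OF C order_refl, of w] wE unfolding u by simp
      ultimately show ?thesis using k by (auto simp: sum_lookup_add sum_lookup_single)
    qed
    then show "u + var_exp p + var_exp q \<in> cover_exponents E k" by (simp add: cover_exponents_def)
  next
    have "sum (Poly_Mapping.lookup (u + var_exp i)) (- A) < k" "sum (Poly_Mapping.lookup (u + var_exp j)) A < k"
      using ij side k by (simp_all add: sum_lookup_add sum_lookup_single)
    then show "u + var_exp i \<notin> cover_exponents E k" "u + var_exp j \<notin> cover_exponents E k"
      unfolding cover_exponents_def using colour_class_cover[OF A] by (auto simp: not_le[symmetric])
  qed
qed

end

context tree_with_leaf
begin

text \<open>A cover need not contain both ends of the leaf, and the weight of a cover that misses \<open>v\<close> does not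
  depend on the exponent of \<open>x\<^sub>v\<close>.\<close>

lemma cover_exponents_saturated_at_leaf:
  assumes "\<And>v. v \<in> {a, b} \<Longrightarrow> \<exists>s. Poly_Mapping.single v s + t \<in> cover_exponents E k"
  shows "t \<in> cover_exponents E k"
  unfolding cover_exponents_def
proof (intro CollectI allI impI)
  fix C assume C: "vertex_cover E C"
  define D where "D = (if b \<in> C then C - {a} else C)"
  have D: "vertex_cover E D" using C cover_remove_a[OF C] by (simp add: D_def)
  have "\<exists>v. v \<in> {a, b} \<and> v \<notin> D" by (auto simp: D_def)
  then obtain v where v: "v \<in> {a, b}" "v \<notin> D" by (elim exE conjE)
  from assms[OF v(1)] obtain s where "Poly_Mapping.single v s + t \<in> cover_exponents E k" by (elim exE)
  then have "k \<le> sum (Poly_Mapping.lookup (Poly_Mapping.single v s + t)) D"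
    using D by (simp add: cover_exponents_def)
  also have "\<dots> = sum (Poly_Mapping.lookup t) D" using v(2) by (simp add: sum_lookup_add sum_lookup_single)
  also have "\<dots> \<le> sum (Poly_Mapping.lookup t) C" by (rule sum_mono2) (auto simp: D_def)
  finally show "k \<le> sum (Poly_Mapping.lookup t) C" .
qed

lemma identify_vars_cover_exponents:
  "t \<in> identify_vars a b (cover_exponents E k) \<longleftrightarrow> in_identified_power a b k (Poly_Mapping.lookup t)"
proof
  assume "t \<in> identify_vars a b (cover_exponents E k)"
  then show "in_identified_power a b k (Poly_Mapping.lookup t)"
    unfolding identify_vars_def in_identified_power_def cover_exponents_def by auto
next
  assume "in_identified_power a b k (Poly_Mapping.lookup t)"
  then obtain y where y: "\<forall>v. v \<noteq> a \<longrightarrow> v \<noteq> b \<longrightarrow> y v = Poly_Mapping.lookup t v"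
    "y a + y b = Poly_Mapping.lookup t a + Poly_Mapping.lookup t b" "\<forall>C. vertex_cover E C \<longrightarrow> k \<le> sum y C"
    unfolding in_identified_power_def by (elim exE conjE)
  then show "t \<in> identify_vars a b (cover_exponents E k)"
    unfolding identify_vars_def cover_exponents_def
    by (intro CollectI bexI[of _ "Abs_poly_mapping y"]) (simp_all add: lookup_Abs_finite)
qed

lemma depth_power_ge_one:
  "1 \<le> k \<Longrightarrow> 1 \<le> depth_quotient graded_maximal_ideal (monomial_ideal (cover_exponents E k) :: ('v, 'k::field) mpoly set)"
  by (rule depth_ge_one[OF a_neq_b upward_closed_cover_exponents cover_exponents_nonzero cover_exponents_saturated_at_leaf])

lemma depth_low_power_ge_two:
  assumes k: "1 \<le> k" "k \<le> card inner_edges"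
  shows "2 \<le> depth_quotient graded_maximal_ideal (monomial_ideal (cover_exponents E k) :: ('v, 'k::field) mpoly set)"
proof (rule depth_ge_two[OF a_neq_b upward_closed_cover_exponents cover_exponents_nonzero[OF k(1)] cover_exponents_saturated_at_leaf])
  fix t assume sat: "\<And>v. v \<in> - {a} \<Longrightarrow> \<exists>s. Poly_Mapping.single v s + t \<in> identify_vars a b (cover_exponents E k)"
  have "in_identified_power a b k (Poly_Mapping.lookup t)"
  proof (rule in_identified_power_saturated[OF k])
    fix v assume "v \<noteq> a"
    then obtain s where "in_identified_power a b k (Poly_Mapping.lookup (Poly_Mapping.single v s + t))"
      using sat[of v] unfolding identify_vars_cover_exponents by auto
    moreover have "Poly_Mapping.lookup (Poly_Mapping.single v s + t)
      = (Poly_Mapping.lookup t)(v := Poly_Mapping.lookup t v + s)"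
      by (auto simp: lookup_add lookup_single when_def)
    ultimately show "\<exists>s. in_identified_power a b k ((Poly_Mapping.lookup t)(v := Poly_Mapping.lookup t v + s))" by auto
  qed
  then show "t \<in> identify_vars a b (cover_exponents E k)" by (simp add: identify_vars_cover_exponents)
qed

end

context tree_graph
begin

lemma dstab_edge_ideal:
  "dstab (edge_ideal E :: ('v, 'k::field) mpoly set) = CARD('v) - card (leaves E)"
proof (cases "E = {}")
  case True
  have "vertex_cover E {}" using True by (simp add: vertex_cover_def)
  then have "cover_exponents E k = {}" if "1 \<le> k" for k using that by (auto simp: cover_exponents_def)
  then have "dstab (edge_ideal E :: ('v, 'k) mpoly set) = 1"
    unfolding dstab_def edge_ideal_power by (intro Least_equality) auto
  moreover have "CARD('v) = 1" "card (leaves E) = 0" using card_edges True by (simp_all add: leaves_def)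
  ultimately show ?thesis by simp
next
  case False
  then obtain a b where ab: "{a, b} \<in> E" "a \<notin> \<Union>(E - {{a, b}})"
    using leaf_in_subgraph[of E] by auto
  interpret tree_with_leaf E a b
    by unfold_locales (use ab in auto)
  let ?N = "Suc (card inner_edges)"
  let ?d = "\<lambda>k. depth_quotient graded_maximal_ideal (monomial_ideal (cover_exponents E k) :: ('v, 'k) mpoly set)"
  have one: "?d k = 1" if "?N \<le> k" for k
    using that depth_high_power_le_one[OF False that] by (intro antisym depth_power_ge_one) auto
  have "dstab (edge_ideal E :: ('v, 'k) mpoly set) = ?N"
    unfolding dstab_def edge_ideal_power
  proof (rule Least_equality)
    show "1 \<le> ?N \<and> (\<forall>l\<ge>?N. ?d ?N = ?d l)" using one by simp
    fix k assume k: "1 \<le> k \<and> (\<forall>l\<ge>k. ?d k = ?d l)"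
    show "?N \<le> k"
    proof (rule ccontr)
      assume lt: "\<not> ?N \<le> k"
      then have "2 \<le> ?d k" using k by (intro depth_low_power_ge_two) auto
      moreover have "?d k = ?d ?N" using k lt by (meson nat_le_linear)
      ultimately have "(2::enat) \<le> 1" using one[of ?N] by simp
      then show False by simp
    qed
  qed
  then show ?thesis using card_inner[OF False] by simp
qed

end

theorem theorem2p1:
  fixes E :: "'n::finite set set" and I :: "('n, 'k::field) mpoly set"
    and n m :: nat
  assumes tree: "graph_tree E"
    and n: "n = CARD('n)"
    and m: "m = card (leaves E)"
    and I: "I = edge_ideal E"
  shows "dstab I \<le> n - m \<and>
    (\<forall>P. longest_path E P \<and> (\<forall>v. dist_to_path E v P \<le> 2) \<longrightarrow> dstab I = n - m)"
proof -
  interpret tree_graph E by unfold_locales (rule tree)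
  show ?thesis unfolding I n m dstab_edge_ideal by simp
qed

end
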